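(* Let $p,q,r$ be distinct primes, let $N=pqr$, and let $A\subset \mathbb{Z}_{N}$ be a nonempty subset. Then the following are equivalent. (1) The set $A$ satisfies the conditions (T1) and (T2). (2) The set $A$ is a spectral set in $\mathbb{Z}_{N}$. (3) The set $A$ tiles $\mathbb{Z}_{N}$ by translation.
   Context: $\mathbb{Z}_N=\mathbb{Z}/N\mathbb{Z}$ is identified with $\{0,1,\dots,N-1\}$ when elements are used as exponents. $\omega_N=e^{2\pi i/N}$. Spectral set: $A\subset\mathbb{Z}_N$ is spectral if there is $B\subset\mathbb{Z}_N$ such that the functions $x\mapsto\omega_N^{bx}$, $b\in B$, form an orthogonal basis of $L^2(A)$ (counting measure); equivalently $\sharp A=\sharp B$ and $\sum_{a\in A}\omega_N^{(b-b')a}=0$ for all distinct $b,b'\in B$. Tile: $A$ tiles $\mathbb{Z}_N$ by translation if there is $T\subset\mathbb{Z}_N$ such that $\mathbb{Z}_N$ is the disjoint union of the translates $A+t$, $t\in T$. Mask polynomial: $A(X)=\sum_{a\in A}X^a\in\mathbb{Z}[X]$, with exponents in $\{0,\dots,N-1\}$. Let $\Phi_n$ be the $n$-th cyclotomic polynomial, let $S$ be the set of prime powers ($>1$) dividing $N$, and let $S_A=\{s\in S:\Phi_s(X)\mid A(X)\}$. (T1): $\sharp A=\prod_{s\in S_A}\Phi_s(1)$ (an empty product is $1$). (T2): $\Phi_{s_1s_2\cdots s_m}(X)$ divides $A(X)$ whenever $s_1,\dots,s_m\in S_A$ are powers of distinct primes. *)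

theory Defs
  imports "HOL-Library.Disjoint_Sets" "HOL-Number_Theory.Number_Theory" "HOL-Computational_Algebra.Computational_Algebra"
begin

section \<open>Cyclotomic polynomials\<close>

definition primitive_roots_unity :: "nat \<Rightarrow> complex set" where
  "primitive_roots_unity n = {z. z ^ n = 1 \<and> (\<forall>m. 0 < m \<and> m < n \<longrightarrow> z ^ m \<noteq> 1)}"

text \<open>The integer polynomial whose image in \<open>\<complex>[X]\<close> is the product of \<open>X - z\<close> over the primitive
  \<open>n\<close>-th roots of unity \<open>z\<close>. Lemma \<open>cyclotomic_poly\<close> below shows that it exists
  for every \<open>n > 0\<close>; the value at \<open>n = 0\<close> is irrelevant.\<close>

definition cyclotomic :: "nat \<Rightarrow> int poly" where
  "cyclotomic n =
     (THE P. map_poly complex_of_int P = (\<Prod>z\<in>primitive_roots_unity n. [:- z, 1:]))"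

lemma map_poly_of_int_mult:
  "map_poly complex_of_int (p * q) = map_poly complex_of_int p * map_poly complex_of_int q"
  by (rule poly_eqI) (simp add: coeff_map_poly coeff_mult)

lemma map_poly_of_int_add:
  "map_poly complex_of_int (p + q) = map_poly complex_of_int p + map_poly complex_of_int q"
  by (rule poly_eqI) (simp add: coeff_map_poly)

lemma map_poly_of_int_1: "map_poly complex_of_int 1 = 1"
  by (rule poly_eqI) (simp add: coeff_map_poly)

lemma map_poly_of_int_prod:
  "map_poly complex_of_int (\<Prod>x\<in>I. f x) = (\<Prod>x\<in>I. map_poly complex_of_int (f x))"
  by (induction I rule: infinite_finite_induct)
     (simp_all add: map_poly_of_int_1 map_poly_of_int_mult)

lemma map_poly_of_int_eq_iff:
  "map_poly complex_of_int p = map_poly complex_of_int q \<longleftrightarrow> p = q"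
  by (auto simp: poly_eq_iff coeff_map_poly)

lemma finite_primitive_roots_unity:
  assumes "n > 0"
  shows "finite (primitive_roots_unity n)"
  by (rule finite_subset[OF _ finite_roots_unity[of n]])
     (use assms in \<open>auto simp: primitive_roots_unity_def\<close>)

lemma roots_unity_partition:
  assumes "n > 0"
  shows "{z::complex. z ^ n = 1} = (\<Union>d\<in>{d. d dvd n}. primitive_roots_unity d)"
proof (intro equalityI subsetI)
  fix z :: complex
  assume z: "z \<in> {z. z ^ n = 1}"
  define d where "d = (LEAST m. 0 < m \<and> z ^ m = 1)"
  have d: "0 < d \<and> z ^ d = 1"
    unfolding d_def by (rule LeastI[of _ n]) (use z assms in auto)
  have min: "z ^ m \<noteq> 1" if "0 < m" "m < d" for m
    using not_less_Least[of m "\<lambda>m. 0 < m \<and> z ^ m = 1"] that unfolding d_def by auto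
  have "z ^ n = (z ^ d) ^ (n div d) * z ^ (n mod d)"
    by (simp flip: power_mult power_add)
  with z d have "z ^ (n mod d) = 1" by simp
  with min[of "n mod d"] d have "n mod d = 0" by (cases "n mod d = 0") auto
  hence "d dvd n" by auto
  with d min show "z \<in> (\<Union>d\<in>{d. d dvd n}. primitive_roots_unity d)"
    by (auto simp: primitive_roots_unity_def)
qed (auto simp: primitive_roots_unity_def power_mult elim!: dvdE)

lemma primitive_roots_unity_disjoint:
  assumes "d > 0" "e > 0" "d \<noteq> e"
  shows "primitive_roots_unity d \<inter> primitive_roots_unity e = {}"
  using assms by (auto simp: primitive_roots_unity_def neq_iff)

lemma prod_roots_unity:
  assumes "n > 0"
  shows "(\<Prod>z | z ^ n = 1. [:- z, 1 :: complex:]) = monom 1 n - 1"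
proof (rule poly_eqI_degree_lead_coeff[where A = "{z. z ^ n = 1}" and n = n])
  let ?R = "{z::complex. z ^ n = 1}"
  have fin: "finite ?R" and card: "card ?R = n"
    using assms by (auto intro: finite_roots_unity card_roots_unity_eq)
  have deg: "degree (\<Prod>z\<in>?R. [:- z, 1:]) = n"
    by (subst degree_prod_eq_sum_degree) (use card in auto)
  have lead: "lead_coeff (\<Prod>z\<in>?R. [:- z, 1:]) = 1"
    by (simp add: lead_coeff_prod)
  show "degree (\<Prod>z\<in>?R. [:- z, 1:]) \<le> n" using deg by simp
  show "degree (monom 1 n - 1 :: complex poly) \<le> n"
    by (intro degree_diff_le) (auto simp: degree_monom_le)
  show "coeff (\<Prod>z\<in>?R. [:- z, 1:]) n = coeff (monom 1 n - 1) n"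
    using lead deg assms by simp
  show "n \<le> card ?R" using card by simp
  show "poly (\<Prod>z\<in>?R. [:- z, 1:]) z = poly (monom 1 n - 1) z" if "z \<in> ?R" for z
    using that fin by (auto simp: poly_prod poly_monom)
qed

lemma prod_primitive_roots_unity:
  assumes "n > 0"
  shows "(\<Prod>d | d dvd n. \<Prod>z\<in>primitive_roots_unity d. [:- z, 1:]) = monom 1 n - 1"
proof -
  have pos: "d > 0" if "d dvd n" for d using that assms by (auto intro: Nat.gr0I)
  have "(\<Prod>z | z ^ n = 1. [:- z, 1 :: complex:]) =
        (\<Prod>d | d dvd n. \<Prod>z\<in>primitive_roots_unity d. [:- z, 1:])"
    unfolding roots_unity_partition[OF assms]
    by (rule prod.UNION_disjoint)
       (use assms pos finite_primitive_roots_unity primitive_roots_unity_disjoint in auto)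
  with prod_roots_unity[OF assms] show ?thesis by simp
qed

lemma cyclotomic_exists:
  assumes "n > 0"
  shows "\<exists>P. map_poly complex_of_int P = (\<Prod>z\<in>primitive_roots_unity n. [:- z, 1:])"
  using assms
proof (induction n rule: less_induct)
  case (less n)
  let ?C = "\<lambda>d. \<Prod>z\<in>primitive_roots_unity d. [:- z, 1:]"
  let ?D = "{d. d dvd n} - {n}"
  have "\<forall>d\<in>?D. \<exists>P. map_poly complex_of_int P = ?C d"
    using less by (auto intro!: less.IH Nat.gr0I dest: dvd_imp_le simp: le_less)
  then obtain F where F: "map_poly complex_of_int (F d) = ?C d" if "d \<in> ?D" for d
    by metis
  define G where "G = (\<Prod>d\<in>?D. F d)"
  have mapG: "map_poly complex_of_int G = (\<Prod>d\<in>?D. ?C d)"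
    unfolding G_def map_poly_of_int_prod by (intro prod.cong refl F) auto
  have degG: "degree (map_poly complex_of_int P) = degree P" for P
    by (rule degree_map_poly) auto
  have "lead_coeff (map_poly complex_of_int G) = 1"
    unfolding mapG by (simp add: lead_coeff_prod)
  hence leadG: "lead_coeff G = 1" by (simp add: degG coeff_map_poly)
  hence G0: "G \<noteq> 0" by auto
  have C_eq: "map_poly complex_of_int G * ?C n = map_poly complex_of_int (monom 1 n - 1)"
  proof -
    have "(\<Prod>d | d dvd n. ?C d) = ?C n * (\<Prod>d\<in>?D. ?C d)"
      by (rule prod.remove) (use less in auto)
    moreover have "map_poly complex_of_int (monom 1 n - 1) = monom 1 n - 1"
      by (rule poly_eqI) (simp add: coeff_map_poly)
    ultimately show ?thesis
      using prod_primitive_roots_unity[OF less.prems] mapG by (simp add: mult.commute)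
  qed
  obtain Q R where QR: "pseudo_divmod (monom 1 n - 1) G = (Q, R)" by fastforce
  have eq: "monom 1 n - 1 = G * Q + R" and deg: "R = 0 \<or> degree R < degree G"
    using pseudo_divmod[OF G0 QR] leadG by simp_all
  let ?m = "map_poly complex_of_int"
  have *: "?m G * (?C n - ?m Q) = ?m R"
    using C_eq unfolding eq map_poly_of_int_add map_poly_of_int_mult
    by (simp add: algebra_simps)
  have "?C n - ?m Q = 0"
  proof (rule ccontr)
    assume nz: "?C n - ?m Q \<noteq> 0"
    have mG0: "?m G \<noteq> 0" using G0 map_poly_of_int_eq_iff[of G 0] by simp
    have "degree (?m R) = degree (?m G) + degree (?C n - ?m Q)"
      unfolding *[symmetric] using nz mG0 by (rule degree_mult_eq[rotated])
    moreover have "R \<noteq> 0" using * nz mG0 by auto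
    ultimately show False using deg by (simp add: degG)
  qed
  thus ?case by auto
qed

lemma cyclotomic_poly:
  assumes "n > 0"
  shows "map_poly complex_of_int (cyclotomic n) = (\<Prod>z\<in>primitive_roots_unity n. [:- z, 1:])"
  unfolding cyclotomic_def
  by (rule theI', rule ex_ex1I[OF cyclotomic_exists[OF assms]])
     (metis map_poly_of_int_eq_iff)

section \<open>Mask polynomials and the conditions (T1) and (T2)\<close>

text \<open>From here on, \<open>\<int>\<^sub>N\<close> is the set \<open>{..<N}\<close> of natural numbers with addition modulo \<open>N\<close>.\<close>

definition mask_poly :: "nat set \<Rightarrow> int poly" where
  "mask_poly A = (\<Sum>a\<in>A. monom 1 a)"

definition cyclotomic_prime_powers :: "nat \<Rightarrow> nat set \<Rightarrow> nat set" where
  "cyclotomic_prime_powers N A = {s \<in> primepow_factors N. cyclotomic s dvd mask_poly A}"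

definition T1 :: "nat \<Rightarrow> nat set \<Rightarrow> bool" where
  "T1 N A \<longleftrightarrow> int (card A) = (\<Prod>s\<in>cyclotomic_prime_powers N A. poly (cyclotomic s) 1)"

text \<open>For a prime power \<open>s\<close>, \<open>aprimedivisor s\<close> is the prime of which \<open>s\<close> is a power. Powers of
  distinct primes are distinct, so \<open>s\<^sub>1, \<dots>, s\<^sub>m\<close> with \<open>m \<ge> 1\<close> is given as a nonempty finite set.\<close>

definition T2 :: "nat \<Rightarrow> nat set \<Rightarrow> bool" where
  "T2 N A \<longleftrightarrow>
     (\<forall>F. finite F \<and> F \<noteq> {} \<and> F \<subseteq> cyclotomic_prime_powers N A \<and> inj_on aprimedivisor F
        \<longrightarrow> cyclotomic (\<Prod>F) dvd mask_poly A)"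

section \<open>Spectral sets and tiles\<close>

definition \<omega> :: "nat \<Rightarrow> complex" where
  "\<omega> N = exp (2 * of_real pi * \<i> / of_nat N)"

definition l2_inner :: "'a set \<Rightarrow> ('a \<Rightarrow> complex) \<Rightarrow> ('a \<Rightarrow> complex) \<Rightarrow> complex" where
  "l2_inner A f g = (\<Sum>x\<in>A. f x * cnj (g x))"

text \<open>For finite \<open>A\<close> and \<open>B\<close>: the family of restrictions to \<open>A\<close> of the functions \<open>\<chi> b\<close>, \<open>b \<in> B\<close>,
  is an orthogonal basis of \<open>L\<^sup>2(A)\<close>. The condition that they are nonzero
  yields linear independence.\<close>

definition orthogonal_basis ::
    "'a set \<Rightarrow> 'b set \<Rightarrow> ('b \<Rightarrow> 'a \<Rightarrow> complex) \<Rightarrow> bool" where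
  "orthogonal_basis A B \<chi> \<longleftrightarrow>
     (\<forall>b\<in>B. \<exists>x\<in>A. \<chi> b x \<noteq> 0) \<and>
     pairwise (\<lambda>b b'. l2_inner A (\<chi> b) (\<chi> b') = 0) B \<and>
     (\<forall>f. \<exists>c. \<forall>x\<in>A. f x = (\<Sum>b\<in>B. c b * \<chi> b x))"

definition spectral :: "nat \<Rightarrow> nat set \<Rightarrow> bool" where
  "spectral N A \<longleftrightarrow> (\<exists>B \<subseteq> {..<N}. orthogonal_basis A B (\<lambda>b x. \<omega> N ^ (b * x)))"

lemma norm_omega: "norm (\<omega> N) = 1"
  unfolding \<omega>_def by (simp add: norm_exp_eq_Re)

lemma omega_nonzero: "\<omega> N \<noteq> 0"
  by (simp add: \<omega>_def)

lemma cnj_omega_power: "cnj (\<omega> N ^ k) = inverse (\<omega> N ^ k)"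
proof -
  have "\<omega> N ^ k * cnj (\<omega> N ^ k) = 1"
    by (metis complex_norm_square norm_omega norm_power of_real_1 power_one)
  thus ?thesis by (metis inverse_unique)
qed

lemma l2_inner_characters:
  "l2_inner A (\<lambda>x. \<omega> N ^ (b * x)) (\<lambda>x. \<omega> N ^ (b' * x)) =
     (\<Sum>a\<in>A. \<omega> N powi ((int b - int b') * int a))"
proof -
  have "\<omega> N ^ (b * a) * cnj (\<omega> N ^ (b' * a)) = \<omega> N powi ((int b - int b') * int a)" for a
    unfolding cnj_omega_power left_diff_distrib power_int_diff[OF disjI1[OF omega_nonzero]]
    by (simp add: divide_inverse flip: of_nat_mult)
  thus ?thesis by (simp add: l2_inner_def)
qed

lemma orthogonal_basis_iff_card:
  assumes fin: "finite A" "finite B" and ne: "A \<noteq> {}"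
    and unim: "\<And>b x. norm (\<chi> b x) = 1"
  shows "orthogonal_basis A B \<chi> \<longleftrightarrow>
           card A = card B \<and> pairwise (\<lambda>b b'. l2_inner A (\<chi> b) (\<chi> b') = 0) B"
proof (cases "pairwise (\<lambda>b b'. l2_inner A (\<chi> b) (\<chi> b') = 0) B")
  case orth: True
  have sq: "\<chi> b x * cnj (\<chi> b x) = 1" for b x
    using unim[of b x] by (simp flip: complex_norm_square)
  have inner: "l2_inner A (\<chi> b) (\<chi> b') = (if b = b' then of_nat (card A) else 0)"
    if "b \<in> B" "b' \<in> B" for b b'
    using that orth by (auto simp: pairwise_def) (simp add: l2_inner_def sq)
  have cardA: "of_nat (card A) \<noteq> (0 :: complex)" using fin ne by simp
  have *: "(\<Sum>b\<in>B. cnj (\<chi> b a) / of_nat (card A) * \<chi> b a) = of_nat (card B) / of_nat (card A)"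
    for a by (simp add: sq mult.commute)
  show ?thesis
  proof
    assume basis: "orthogonal_basis A B \<chi>"
    obtain a where a: "a \<in> A" using ne by auto
    obtain c where c: "(if x = a then 1 else 0) = (\<Sum>b\<in>B. c b * \<chi> b x)" if "x \<in> A" for x
      using basis unfolding orthogonal_basis_def
      by (auto dest!: spec[of _ "\<lambda>x. if x = a then 1 else 0"])
    have "c b = cnj (\<chi> b a) / of_nat (card A)" if b: "b \<in> B" for b
    proof -
      have "cnj (\<chi> b a) = (\<Sum>x\<in>A. (if x = a then 1 else 0) * cnj (\<chi> b x))"
        using a fin by (simp add: if_distrib[of "\<lambda>u. u * _"] cong: if_cong)
      also have "\<dots> = (\<Sum>x\<in>A. (\<Sum>b'\<in>B. c b' * \<chi> b' x) * cnj (\<chi> b x))"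
        by (rule sum.cong) (simp_all add: c)
      also have "\<dots> = (\<Sum>b'\<in>B. c b' * l2_inner A (\<chi> b') (\<chi> b))"
        unfolding l2_inner_def sum_distrib_left sum_distrib_right
        by (subst sum.swap) (simp add: mult_ac)
      also have "\<dots> = (\<Sum>b'\<in>B. if b' = b then c b' * of_nat (card A) else 0)"
        by (rule sum.cong) (simp_all add: inner b)
      also have "\<dots> = c b * of_nat (card A)"
        using b fin by simp
      finally show ?thesis using cardA by (simp add: field_simps)
    qed
    hence "(\<Sum>b\<in>B. cnj (\<chi> b a) / of_nat (card A) * \<chi> b a) = 1"
      using c[OF a] by simp
    with * cardA show "card A = card B \<and> pairwise (\<lambda>b b'. l2_inner A (\<chi> b) (\<chi> b') = 0) B"
      using orth by simp
  next
    assume "card A = card B \<and> pairwise (\<lambda>b b'. l2_inner A (\<chi> b) (\<chi> b') = 0) B"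
    hence card: "card A = card B" ..
    define g where "g = (\<lambda>a x. \<Sum>b\<in>B. cnj (\<chi> b a) / of_nat (card A) * \<chi> b x)"
    have g_diag: "g a a = 1" for a
      unfolding g_def * using cardA card by simp
    have g_norm: "(\<Sum>x\<in>A. g a x * cnj (g a x)) = 1" for a
    proof -
      let ?n = "of_nat (card A) :: complex"
      have "(\<Sum>x\<in>A. g a x * cnj (g a x)) =
            (\<Sum>x\<in>A. \<Sum>b\<in>B. \<Sum>b'\<in>B. cnj (\<chi> b a) / ?n * (\<chi> b' a / ?n) * (\<chi> b x * cnj (\<chi> b' x)))"
        unfolding g_def by (simp add: sum_product mult_ac)
      also have "\<dots> = (\<Sum>b\<in>B. \<Sum>b'\<in>B. cnj (\<chi> b a) / ?n * (\<chi> b' a / ?n) * l2_inner A (\<chi> b) (\<chi> b'))"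
        unfolding l2_inner_def sum_distrib_left
        by (subst sum.swap, intro sum.cong refl, subst sum.swap, intro sum.cong refl)
      also have "\<dots> = (\<Sum>b\<in>B. \<Sum>b'\<in>B. if b' = b then cnj (\<chi> b a) / ?n * (\<chi> b' a / ?n) * ?n else 0)"
        by (intro sum.cong refl) (simp add: inner)
      also have "\<dots> = (\<Sum>b\<in>B. cnj (\<chi> b a) / ?n * \<chi> b a)"
        using fin cardA by simp
      also have "\<dots> = 1" unfolding * using cardA card by simp
      finally show ?thesis .
    qed
    have g: "g a x = (if x = a then 1 else 0)" if a: "a \<in> A" and x: "x \<in> A" for a x
    proof -
      have "complex_of_real (\<Sum>x\<in>A. (norm (g a x))\<^sup>2) = 1"
        using g_norm[of a] unfolding of_real_sum complex_norm_square .
      hence "(\<Sum>x\<in>A. (norm (g a x))\<^sup>2) = 1" by (simp only: of_real_eq_1_iff)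
      hence "(\<Sum>x\<in>A - {a}. (norm (g a x))\<^sup>2) = 0"
        using sum.remove[OF fin(1) a, of "\<lambda>x. (norm (g a x))\<^sup>2"] g_diag[of a] by simp
      hence "\<forall>x\<in>A - {a}. (norm (g a x))\<^sup>2 = 0"
        using fin by (subst (asm) sum_nonneg_eq_0_iff) auto
      thus ?thesis using x g_diag by auto
    qed
    have "\<exists>c. \<forall>x\<in>A. f x = (\<Sum>b\<in>B. c b * \<chi> b x)" for f
    proof (intro exI ballI)
      fix x assume x: "x \<in> A"
      have "f x = (\<Sum>a\<in>A. if a = x then f a else 0)" using x fin by simp
      also have "\<dots> = (\<Sum>a\<in>A. f a * g a x)"
        by (intro sum.cong refl) (use x g in auto)
      also have "\<dots> = (\<Sum>b\<in>B. (\<Sum>a\<in>A. f a * (cnj (\<chi> b a) / of_nat (card A))) * \<chi> b x)"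
        unfolding g_def sum_distrib_left sum_distrib_right
        by (subst sum.swap) (simp add: mult_ac)
      finally show "f x = (\<Sum>b\<in>B. (\<Sum>a\<in>A. f a * (cnj (\<chi> b a) / of_nat (card A))) * \<chi> b x)" .
    qed
    moreover have "\<chi> b x \<noteq> 0" for b x using unim[of b x] by auto
    ultimately show "orthogonal_basis A B \<chi>"
      using orth ne unfolding orthogonal_basis_def by blast
  qed
qed (auto simp: orthogonal_basis_def)

lemma spectral_iff:
  assumes "finite A" "A \<noteq> {}"
  shows "spectral N A \<longleftrightarrow>
    (\<exists>B \<subseteq> {..<N}. card A = card B \<and>
      (\<forall>b\<in>B. \<forall>b'\<in>B. b \<noteq> b' \<longrightarrow> (\<Sum>a\<in>A. \<omega> N powi ((int b - int b') * int a)) = 0))"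
proof -
  have "orthogonal_basis A B (\<lambda>b x. \<omega> N ^ (b * x)) \<longleftrightarrow> card A = card B \<and>
      (\<forall>b\<in>B. \<forall>b'\<in>B. b \<noteq> b' \<longrightarrow> (\<Sum>a\<in>A. \<omega> N powi ((int b - int b') * int a)) = 0)"
    if "B \<subseteq> {..<N}" for B
    using that finite_subset[OF that] assms
    by (subst orthogonal_basis_iff_card)
       (auto simp: norm_power norm_omega l2_inner_characters pairwise_def)
  thus ?thesis unfolding spectral_def by blast
qed

definition translate :: "nat \<Rightarrow> nat set \<Rightarrow> nat \<Rightarrow> nat set" where
  "translate N A t = (\<lambda>a. (a + t) mod N) ` A"

definition tiles :: "nat \<Rightarrow> nat set \<Rightarrow> bool" where
  "tiles N A \<longleftrightarrow>
     (\<exists>T \<subseteq> {..<N}. disjoint_family_on (translate N A) T \<and> (\<Union>t\<in>T. translate N A t) = {..<N})"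

end

theory Submission
  imports Defs
begin

text \<open>
Each of the three conditions says that \<open>A\<close> is a complete system of residues
modulo some divisor \<open>M\<close> of \<open>N\<close>, written \<open>transversal M A\<close>; necessarily \<open>M = card A\<close>.

For (T1) and (T2) this is Fourier inversion on the integers modulo \<open>M\<close>, where \<open>M\<close> is the product of the primes
\<open>s\<close> with \<open>\<Phi>\<^sub>s\<close> dividing the mask polynomial: (T2) makes the mask polynomial vanish at every \<open>M\<close>-th root
of unity other than 1, so \<open>A\<close> is equidistributed modulo \<open>M\<close>, and (T1) leaves one element
for each class (\<open>T1_T2_iff_transversal\<close>). A complete system of residues is tiled with the multiples of \<open>M\<close>, and
it has the multiples of \<open>N / M\<close> as a spectrum.

Conversely, let \<open>A\<close> tile with translation set \<open>T\<close>. By Tijdeman's theorem \<open>T\<close> may be replaced by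
\<open>k T\<close> for every \<open>k\<close> coprime to its size. As \<open>N\<close> is squarefree, \<open>k = card A\<close> is allowed, and then
every translate is by a multiple of \<open>card A\<close>, so \<open>A\<close> meets every class modulo \<open>card A\<close>
(\<open>tiles_imp_transversal\<close>).

Only the passage from spectral to \<open>transversal\<close> uses that there are three primes. Let \<open>B\<close> be a spectrum of
\<open>A\<close>; completeness of the basis makes \<open>A\<close> a spectrum of \<open>B\<close> as well. If \<open>b - b'\<close> has order \<open>d\<close> modulo
\<open>N\<close>, the character sum of \<open>A\<close> vanishes at one primitive \<open>d\<close>-th root of unity and hence, cyclotomic polynomials
being irreducible, at all of them: \<open>vanishes d A\<close>. Write elements in coordinates modulo \<open>p\<close>, \<open>q\<close>, \<open>r\<close>.
Vanishing at a prime forces equidistribution, so that prime divides the size of \<open>A\<close>; hence a prime not dividing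
the size cannot be the only coordinate in which two elements of \<open>A\<close> or of \<open>B\<close> differ. If two of
the primes divide the size, this already pins the size down (\<open>two_primes_dvd_card\<close>). Otherwise, say, \<open>q\<close> and \<open>r\<close> do
not divide it. If \<open>vanishes (p q r)\<close> holds for \<open>A\<close>, the alternating sum over the corners of a box forces
\<open>A\<close> to contain the whole line in direction \<open>p\<close> through each of its points (\<open>line_full\<close>). If it holds
for both sets, then \<open>A\<close> is one such line (\<open>transversal_if_both_vanish\<close>). If it fails for
\<open>A\<close>, any two points of \<open>B\<close> share a coordinate; combined with the bound \<open>card A \<ge> q + r\<close> that follows
from \<open>vanishes (q r) A\<close> (\<open>vanishes_two_primes_card_ge\<close>), this makes \<open>B\<close> injective modulo \<open>p\<close>
(\<open>injective_mod_p\<close>), and then either the size is 1 or both sets are complete systems of residues modulo \<open>p\<close>.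
\<close>

section \<open>Conjugate roots of unity\<close>

definition eval_at :: "complex \<Rightarrow> int poly \<Rightarrow> complex" where
  "eval_at z F = poly (map_poly complex_of_int F) z"

lemma eval_at_simps [simp]:
  "eval_at z 0 = 0" "eval_at z 1 = 1"
  "eval_at z (F + G) = eval_at z F + eval_at z G"
  "eval_at z (F * G) = eval_at z F * eval_at z G"
  "eval_at z (monom 1 k) = z ^ k"
  "eval_at z [:c:] = of_int c"
  "eval_at z (smult c F) = of_int c * eval_at z F"
  by (simp_all add: eval_at_def map_poly_of_int_1 map_poly_of_int_add map_poly_of_int_mult
        map_poly_monom poly_monom map_poly_pCons map_poly_smult)

lemma eval_at_uminus [simp]: "eval_at z (- F) = - eval_at z F"
  using eval_at_simps(3)[of z "-F" F] by (simp add: eq_neg_iff_add_eq_0)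

lemma eval_at_diff [simp]: "eval_at z (F - G) = eval_at z F - eval_at z G"
  using eval_at_simps(3)[of z F "-G"] by simp

lemma eval_at_power [simp]: "eval_at z (F ^ k) = eval_at z F ^ k"
  by (induction k) simp_all

lemma eval_at_sum [simp]: "eval_at z (\<Sum>i\<in>I. F i) = (\<Sum>i\<in>I. eval_at z (F i))"
  by (induction I rule: infinite_finite_induct) simp_all

lemma eval_at_pCons [simp]: "eval_at z (pCons a F) = of_int a + z * eval_at z F"
  by (simp add: eval_at_def map_poly_pCons)

lemma eval_at_pcompose_monom: "eval_at z (pcompose F (monom 1 k)) = eval_at (z ^ k) F"
  by (induction F) (simp_all add: pcompose_pCons)

text \<open>Both \<open>F \<mapsto> F\<^sup>l\<close> and \<open>F \<mapsto> F(X\<^sup>l)\<close> are ring homomorphisms modulo \<open>l\<close>, and they agree on constants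
by Fermat's little theorem and on \<open>X\<close>.\<close>

lemma power_prime_cong_pcompose:
  fixes F :: "int poly"
  assumes l: "prime l"
  shows "[:int l:] dvd F ^ l - pcompose F (monom 1 l)"
proof (induction F)
  case 0
  show ?case using prime_gt_0_nat[OF l] by (simp add: zero_power)
next
  case (pCons a F)
  have add: "[:int l:] dvd (u + v) ^ l - u ^ l - v ^ l" for u v :: "int poly"
  proof -
    have "(u + v) ^ l = (\<Sum>k\<le>l. of_nat (l choose k) * u ^ k * v ^ (l - k))"
      by (rule binomial_ring)
    also have "{..l} = insert 0 (insert l {0<..<l})" using prime_gt_0_nat[OF l] by auto
    also have "(\<Sum>k\<in>\<dots>. of_nat (l choose k) * u ^ k * v ^ (l - k)) =
        v ^ l + u ^ l + (\<Sum>k\<in>{0<..<l}. of_nat (l choose k) * u ^ k * v ^ (l - k))"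
      using prime_gt_0_nat[OF l] by (subst sum.insert) auto
    finally have "(u + v) ^ l - u ^ l - v ^ l =
        (\<Sum>k\<in>{0<..<l}. of_nat (l choose k) * u ^ k * v ^ (l - k))" by simp
    moreover have "[:int l:] dvd of_nat (l choose k)" if "k \<in> {0<..<l}" for k
    proof -
      have "l dvd l choose k" using that l by (intro dvd_choose_prime) auto
      thus ?thesis by (simp add: of_nat_poly)
    qed
    ultimately show ?thesis by (auto intro!: dvd_sum dvd_mult2)
  qed
  have fermat: "int l dvd a ^ l - a"
  proof -
    have "a = int (nat (a mod int l)) + int l * (a div int l)"
      using prime_gt_0_nat[OF l] by simp
    hence *: "[a = int (nat (a mod int l))] (mod int l)"
      by (metis cong_add_lcancel_0 cong_mult_self_left cong_sym_eq)
    define b where "b = nat (a mod int l)"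
    have "[b ^ l = b] (mod l)"
    proof (cases "l dvd b")
      case True
      hence "l dvd b ^ l" using prime_gt_0_nat[OF l] by (metis dvd_power dvd_trans)
      with True show ?thesis by (simp add: cong_def mod_eq_0_iff_dvd)
    next
      case False
      have "[b ^ (l - 1) * b = 1 * b] (mod l)"
        by (intro cong_mult fermat_theorem[OF l False] cong_refl)
      thus ?thesis using prime_gt_0_nat[OF l]
        by (metis Suc_diff_1 mult_1 power_Suc2)
    qed
    hence "[int b ^ l = int b] (mod int l)" by (metis cong_int_iff of_nat_power)
    with * have "[a ^ l = a] (mod int l)" unfolding b_def
      by (meson cong_pow cong_sym cong_trans)
    thus ?thesis by (simp add: cong_iff_dvd_diff)
  qed
  have split: "pCons a F = [:a:] + monom 1 1 * F"
    by (simp add: monom_altdef)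
  have pc: "pcompose (pCons a F) (monom 1 l) = [:a:] + monom 1 l * pcompose F (monom 1 l)"
    by (simp add: pcompose_pCons)
  have "(pCons a F) ^ l - pcompose (pCons a F) (monom 1 l) =
      ([:a:] + monom 1 1 * F) ^ l - [:a:] ^ l - (monom 1 1 * F) ^ l + ([:a:] ^ l - [:a:])
      + monom 1 l * (F ^ l - pcompose F (monom 1 l))"
    unfolding split pc[unfolded split] by (simp add: power_mult_distrib monom_power algebra_simps)
  moreover have "[:int l:] dvd [:a:] ^ l - [:a:]"
    using fermat by (simp add: poly_const_pow const_poly_dvd_const_poly_iff)
  ultimately show ?case using add pCons.IH by (metis dvd_add dvd_mult)
qed

text \<open>Gauss's lemma: over the fraction field the constant \<open>c\<close> is a unit.\<close>

lemma primitive_dvd_smultD: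
  fixes f F :: "int poly"
  assumes "content f = 1" "c \<noteq> 0" "f dvd smult c F"
  shows "f dvd F"
proof (rule fract_poly_dvdD[OF _ assms(1)])
  have "map_poly to_fract f dvd smult (to_fract c) (map_poly to_fract F)"
    using fract_poly_dvd[OF assms(3)] by simp
  thus "map_poly to_fract f dvd map_poly to_fract F"
    using assms(2) by (simp add: dvd_smult_cancel)
qed

text \<open>The minimal polynomial of a root of unity has integer coefficients. Take the primitive part of a nonzero
integer polynomial of least degree with root \<open>z\<close>: by pseudo-division and Gauss's lemma it divides all
integer polynomials with root \<open>z\<close>. One of them is the monic \<open>X\<^sup>n - 1\<close>, so its leading coefficient is a
unit.\<close>

lemma root_of_unity_min_poly:
  assumes "n > 0" "z ^ n = 1"
  obtains f :: "int poly" where "lead_coeff f = 1" "\<And>F. eval_at z F = 0 \<longleftrightarrow> f dvd F"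
proof -
  let ?P = "\<lambda>F::int poly. F \<noteq> 0 \<and> eval_at z F = 0"
  let ?X = "monom 1 n - 1 :: int poly"
  have X: "?P ?X"
  proof -
    have "coeff ?X n = 1" using assms(1) by simp
    hence "?X \<noteq> 0" by (metis coeff_0 zero_neq_one)
    thus ?thesis using assms(2) by simp
  qed
  have leadX: "lead_coeff ?X = 1"
  proof -
    have "degree ?X = n" using assms(1)
      by (intro antisym degree_diff_le le_degree) (auto simp: degree_monom_le)
    thus ?thesis using assms(1) by simp
  qed
  obtain h where h: "?P h" and min: "\<And>F. ?P F \<Longrightarrow> degree h \<le> degree F"
    using ex_has_least_nat[of ?P, OF X] by blast
  define f where "f = primitive_part h"
  have h_f: "h = smult (content h) f" by (simp add: f_def)
  have "eval_at z h = of_int (content h) * eval_at z f"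
    by (subst h_f) simp
  hence f: "?P f" "content f = 1" "degree f = degree h"
    using h by (auto simp: f_def)
  have dvd: "f dvd F" if F: "eval_at z F = 0" for F
  proof -
    obtain Q R where QR: "pseudo_divmod F f = (Q, R)" by fastforce
    let ?c = "lead_coeff f ^ (Suc (degree F) - degree f)"
    have eq: "smult ?c F = f * Q + R" and deg: "R = 0 \<or> degree R < degree f"
      using pseudo_divmod[OF _ QR] f by auto
    have "eval_at z (smult ?c F) = 0" by (simp only: eval_at_simps F mult_zero_right)
    hence "eval_at z R = 0" unfolding eq using f by simp
    hence "R = 0" using deg min[of R] f(3) by (metis leD)
    hence "f dvd smult ?c F" using eq by simp
    moreover have "?c \<noteq> 0" using f(1) by simp
    ultimately show ?thesis by (rule primitive_dvd_smultD[OF f(2), rotated])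
  qed
  obtain k where "?X = f * k" using dvd[of ?X] X by (auto elim: dvdE)
  hence "lead_coeff f * lead_coeff k = 1" using leadX by (simp add: lead_coeff_mult)
  hence unit: "lead_coeff f * lead_coeff f = 1"
    by (metis dvd_triv_left zdvd1_eq abs_mult_self_eq mult_1)
  define g where "g = smult (lead_coeff f) f"
  have "lead_coeff g = 1" using unit by (simp only: g_def lead_coeff_smult)
  moreover have "eval_at z F = 0 \<longleftrightarrow> g dvd F" for F
  proof
    assume "eval_at z F = 0"
    then obtain K where "F = f * K" using dvd by (auto elim: dvdE)
    hence "F = g * smult (lead_coeff f) K" using unit by (simp add: g_def)
    thus "g dvd F" by (rule dvdI)
  next
    assume "g dvd F"
    then obtain K where "F = g * K" by (auto elim: dvdE)
    thus "eval_at z F = 0" using f by (simp add: g_def)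
  qed
  ultimately show ?thesis using that by blast
qed

text \<open>Dedekind's argument for the irreducibility of cyclotomic polynomials. Let \<open>f\<close> be the minimal polynomial of
\<open>z\<close> and \<open>X\<^sup>n - 1 = f g\<close>. If \<open>z\<^sup>l\<close> is not a root of \<open>f\<close>, it is one of \<open>g\<close>, so \<open>g(z)\<^sup>l\<close> is divisible by \<open>l\<close>
in \<open>\<int>[z]\<close>. But \<open>f'(z) g(z) = n z\<^sup>n\<^sup>-\<^sup>1\<close>, so \<open>n\<^sup>l\<close> is then divisible by \<open>l\<close> in \<open>\<int>[z]\<close>, hence in \<open>\<int>\<close>, which
is excluded.\<close>

lemma eval_at_root_prime_power:
  assumes n: "n > 0" "z ^ n = 1" and l: "prime l" "\<not> l dvd n" and F: "eval_at z F = 0"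
  shows "eval_at (z ^ l) F = 0"
proof -
  obtain f :: "int poly" where lead: "lead_coeff f = 1" and f: "\<And>F. eval_at z F = 0 \<longleftrightarrow> f dvd F"
    using root_of_unity_min_poly[OF n] by blast
  have f0: "eval_at z f = 0" using f by simp
  have f_nz: "f \<noteq> 0" using lead by (metis leading_coeff_0_iff zero_neq_one)
  have deg_f: "degree f > 0"
  proof (rule ccontr)
    assume "\<not> ?thesis"
    hence "f = 1" using lead by (metis degree_eq_zeroE gr0I lead_coeff_pCons(2) one_pCons)
    with f0 show False by simp
  qed
  have "eval_at (z ^ l) f = 0"
  proof (rule ccontr)
    assume nz: "eval_at (z ^ l) f \<noteq> 0"
    obtain g where g: "monom 1 n - 1 = f * g"
      using f[of "monom 1 n - 1"] n(2) by (auto elim: dvdE)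
    have "eval_at (z ^ l) (f * g) = 0"
      unfolding g[symmetric] using n(2)
      by simp (metis power_mult mult.commute power_one)
    hence gzl: "eval_at (z ^ l) g = 0" using nz by simp
    obtain H where H: "g ^ l - pcompose g (monom 1 l) = [:int l:] * H"
      using power_prime_cong_pcompose[OF l(1)] dvdE by blast
    have "eval_at z (g ^ l - pcompose g (monom 1 l)) = eval_at z ([:int l:] * H)"
      by (simp only: H)
    hence gl: "eval_at z g ^ l = of_nat l * eval_at z H"
      using gzl by (simp add: eval_at_pcompose_monom)
    \<comment> \<open>the right-hand side is the derivative of \<open>X\<^sup>n - 1\<close>\<close>
    have "pderiv (f * g) = of_nat n * monom 1 (n - 1)"
      unfolding g[symmetric] by (simp add: pderiv_diff pderiv_monom of_nat_poly smult_monom)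
    hence "eval_at z (pderiv (f * g)) = eval_at z (of_nat n * monom 1 (n - 1))" by (simp only:)
    hence "of_nat n * z ^ (n - 1) = eval_at z (pderiv f) * eval_at z g"
      using f0 by (simp add: pderiv_mult of_nat_poly mult.commute)
    hence "of_nat n * z ^ n = z * eval_at z (pderiv f) * eval_at z g"
      using n(1) by (cases n) (simp_all add: algebra_simps)
    hence "of_nat n ^ l = (z * eval_at z (pderiv f)) ^ l * eval_at z g ^ l"
      unfolding n(2) by (simp add: power_mult_distrib)
    define K where "K = (monom 1 1 * pderiv f) ^ l * H"
    have "of_nat n ^ l = of_nat l * eval_at z K"
      using \<open>of_nat n ^ l = _\<close> unfolding gl K_def by (simp add: algebra_simps)
    \<comment> \<open>after reduction modulo \<open>f\<close>, the degree bound turns the equation \<open>n\<^sup>l = l R(z)\<close> into one of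
      polynomials, whose constant coefficients show that \<open>l\<close> divides \<open>n\<^sup>l\<close>\<close>
    obtain Q R where QR: "pseudo_divmod K f = (Q, R)" by fastforce
    have eq: "K = f * Q + R" and deg: "R = 0 \<or> degree R < degree f"
      using pseudo_divmod[OF f_nz QR] lead by auto
    have "eval_at z ([:int n ^ l:] - smult (int l) R) = 0"
      using \<open>of_nat n ^ l = of_nat l * eval_at z K\<close> f0 by (simp add: eq)
    hence "f dvd [:int n ^ l:] - smult (int l) R" using f by blast
    moreover have "degree ([:int n ^ l:] - smult (int l) R) < degree f"
      using deg deg_f by (intro degree_diff_less) (auto intro: le_less_trans[OF degree_smult_le])
    ultimately have "[:int n ^ l:] = smult (int l) R"
      by (metis dvd_imp_degree_le eq_iff_diff_eq_0 leD)
    hence "int n ^ l = int l * coeff R 0"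
      by (metis coeff_pCons_0 coeff_smult)
    hence "int l dvd int (n ^ l)" by simp
    hence "l dvd n" using l(1) prime_dvd_power by (metis int_dvd_int_iff)
    with l(2) show False by blast
  qed
  thus ?thesis using F f by (auto elim!: dvdE)
qed

text \<open>Raise to the prime factors of \<open>k\<close> one after the other.\<close>

lemma eval_at_root_coprime_power:
  assumes n: "n > 0" "z ^ n = 1" and k: "coprime k n" and F: "eval_at z F = 0"
  shows "eval_at (z ^ k) F = 0"
proof (cases "k = 0")
  case True
  with k n have "n = 1" by simp
  thus ?thesis using n F by simp
next
  case False
  thus ?thesis using k n F
  proof (induction k arbitrary: z rule: prime_divisors_induct)
    case (factor l k)
    have "coprime l n" "coprime k n" "k \<noteq> 0" using factor.prems by auto
    have "\<not> l dvd n" using \<open>coprime l n\<close> factor.hyps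
      by (meson coprime_common_divisor dvd_refl not_prime_unit)
    hence "eval_at (z ^ l) F = 0"
      using eval_at_root_prime_power[OF \<open>n > 0\<close> \<open>z ^ n = 1\<close>] factor by auto
    moreover have "(z ^ l) ^ n = 1" using factor.prems by (metis mult.commute power_mult power_one)
    ultimately show ?case using factor.IH[of "z ^ l"] \<open>coprime k n\<close> \<open>k \<noteq> 0\<close> n(1)
      by (simp add: power_mult)
  qed auto
qed

section \<open>Primitive roots of unity and cyclotomic divisibility\<close>

text \<open>In this form the orders of products and powers become a matter of divisibility.\<close>

lemma mem_primitive_roots_unity_iff:
  assumes "d > 0"
  shows "z \<in> primitive_roots_unity d \<longleftrightarrow> (\<forall>m. z ^ m = 1 \<longleftrightarrow> d dvd m)"
proof
  assume z: "z \<in> primitive_roots_unity d"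
  show "\<forall>m. z ^ m = 1 \<longleftrightarrow> d dvd m"
  proof (intro allI iffI)
    fix m assume m: "z ^ m = 1"
    have "z ^ m = (z ^ d) ^ (m div d) * z ^ (m mod d)"
      by (simp flip: power_mult power_add)
    with m z have "z ^ (m mod d) = 1" by (simp add: primitive_roots_unity_def)
    hence "m mod d = 0" using z assms by (auto simp: primitive_roots_unity_def)
    thus "d dvd m" by auto
  qed (use z in \<open>auto simp: primitive_roots_unity_def power_mult elim!: dvdE\<close>)
qed (use assms in \<open>auto simp: primitive_roots_unity_def dest: dvd_imp_le\<close>)

lemma primitive_roots_unity_mult:
  assumes "z \<in> primitive_roots_unity d" "w \<in> primitive_roots_unity e"
    and "d > 0" "e > 0" "coprime d e"
  shows "z * w \<in> primitive_roots_unity (d * e)"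
proof -
  have z: "z ^ m = 1 \<longleftrightarrow> d dvd m" and w: "w ^ m = 1 \<longleftrightarrow> e dvd m" for m
    using assms by (simp_all add: mem_primitive_roots_unity_iff)
  have "(z * w) ^ m = 1 \<longleftrightarrow> d * e dvd m" for m
  proof
    assume zw: "(z * w) ^ m = 1"
    have "(z * w) ^ (m * e) = 1" "(z * w) ^ (m * d) = 1" by (simp_all add: power_mult zw)
    moreover have "w ^ (m * e) = 1" "z ^ (m * d) = 1" by (simp_all add: z w)
    ultimately have "z ^ (m * e) = 1" "w ^ (m * d) = 1" by (simp_all add: power_mult_distrib)
    hence "d dvd m * e" "e dvd m * d" by (simp_all add: z w)
    thus "d * e dvd m" using \<open>coprime d e\<close>
      by (metis coprime_commute coprime_dvd_mult_left_iff divides_mult)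
  next
    assume "d * e dvd m"
    hence "d dvd m" "e dvd m" by (auto intro: dvd_mult_left dvd_mult_right)
    hence "z ^ m = 1" "w ^ m = 1" by (simp_all add: z w)
    thus "(z * w) ^ m = 1" by (simp add: power_mult_distrib)
  qed
  thus ?thesis using assms by (simp add: mem_primitive_roots_unity_iff)
qed

text \<open>The first \<open>d\<close> powers of \<open>z\<close> are distinct, and there are only \<open>d\<close> roots of unity of exponent \<open>d\<close>.\<close>

lemma primitive_root_generates:
  assumes "d > 0" "z \<in> primitive_roots_unity d" "w ^ d = 1"
  obtains k where "w = z ^ k"
proof -
  have z: "z ^ m = 1 \<longleftrightarrow> d dvd m" for m
    using assms by (simp add: mem_primitive_roots_unity_iff)
  have z0: "z \<noteq> 0" using z[of d] \<open>d > 0\<close> by (auto simp: power_0_left)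
  have le: "i = j" if "z ^ i = z ^ j" "i \<le> j" "j < d" for i j
  proof -
    have "z ^ j = z ^ i * z ^ (j - i)" unfolding power_add[symmetric] using that by simp
    hence "z ^ (j - i) = 1" using that z0 by simp
    hence "d dvd j - i" by (simp add: z)
    thus ?thesis using that by (auto dest: dvd_imp_le)
  qed
  have "inj_on (\<lambda>k. z ^ k) {..<d}"
    by (rule inj_onI) (metis le lessThan_iff nat_le_linear)
  hence "card ((\<lambda>k. z ^ k) ` {..<d}) = card {w::complex. w ^ d = 1}"
    using card_roots_unity_eq[OF assms(1)] by (simp add: card_image)
  moreover have "(\<lambda>k. z ^ k) ` {..<d} \<subseteq> {w::complex. w ^ d = 1}"
    using z by (auto simp flip: power_mult)
  ultimately have "(\<lambda>k. z ^ k) ` {..<d} = {w::complex. w ^ d = 1}"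
    using \<open>d > 0\<close> by (intro card_subset_eq finite_roots_unity) auto
  thus ?thesis using assms(3) that by blast
qed

lemma primitive_roots_unity_power_coprime:
  assumes "d > 0" "z \<in> primitive_roots_unity d" "z ^ k \<in> primitive_roots_unity d"
  shows "coprime k d"
proof -
  have z: "z ^ m = 1 \<longleftrightarrow> d dvd m" and w: "(z ^ k) ^ m = 1 \<longleftrightarrow> d dvd m" for m
    using assms by (simp_all add: mem_primitive_roots_unity_iff)
  define g where "g = gcd k d"
  have g: "g dvd k" "g dvd d" "g > 0" using assms(1) by (auto simp: g_def)
  then obtain a b where ab: "k = g * a" "d = g * b" by (auto elim!: dvdE)
  have "(z ^ k) ^ b = 1" unfolding power_mult[symmetric] z by (simp add: ab)
  hence "d dvd b" using w by blast
  hence "g * b dvd 1 * b" using ab by simp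
  moreover have "b \<noteq> 0" using ab assms(1) by (metis mult_0_right not_less_zero)
  ultimately have "g dvd 1" using dvd_times_right_cancel_iff[of b g 1] by simp
  thus ?thesis unfolding g_def by (metis coprime_iff_gcd_eq_1 nat_dvd_1_iff_1)
qed

lemma omega_primitive:
  assumes "N > 0"
  shows "\<omega> N \<in> primitive_roots_unity N"
proof -
  have w: "\<omega> N ^ k = cis (2 * pi * real k / real N)" for k
    unfolding \<omega>_def by (simp add: cis_conv_exp flip: exp_of_nat_mult) (simp add: field_simps)
  have inj: "inj_on (\<lambda>k. cis (2 * pi * real k / real N)) {..<N}"
    using bij_betw_roots_unity[OF assms] by (simp add: bij_betw_def)
  have "\<omega> N ^ N = 1" using assms by (simp add: w)
  moreover have "\<omega> N ^ m \<noteq> 1" if "0 < m" "m < N" for m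
    using inj_onD[OF inj, of m 0] that unfolding w by auto
  ultimately show ?thesis by (simp add: primitive_roots_unity_def)
qed

text \<open>The analytic form of \<open>\<Phi>\<^sub>d\<close> dividing the mask polynomial of \<open>A\<close>: the character sum of \<open>A\<close> is zero at
every frequency of order \<open>d\<close>.\<close>

definition vanishes :: "nat \<Rightarrow> nat set \<Rightarrow> bool" where
  "vanishes d A \<longleftrightarrow> (\<forall>z\<in>primitive_roots_unity d. (\<Sum>a\<in>A. z ^ a) = 0)"

lemma eval_at_mask_poly: "eval_at z (mask_poly A) = (\<Sum>a\<in>A. z ^ a)"
  by (simp add: mask_poly_def)

text \<open>Galois conjugation: one primitive root suffices, since all others are its coprime powers. This turns the
orthogonality relations of a spectrum, each of which concerns a single root, into statements about cyclotomic
divisors.\<close>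

lemma vanishesI:
  assumes "d > 0" "z \<in> primitive_roots_unity d" "(\<Sum>a\<in>A. z ^ a) = 0"
  shows "vanishes d A"
  unfolding vanishes_def
proof
  fix w assume w: "w \<in> primitive_roots_unity d"
  then obtain k where k: "w = z ^ k"
    using primitive_root_generates[OF assms(1,2)] by (auto simp: primitive_roots_unity_def)
  have "coprime k d"
    using primitive_roots_unity_power_coprime[OF assms(1,2)] w k by simp
  thus "(\<Sum>a\<in>A. w ^ a) = 0"
    using eval_at_root_coprime_power[of d z k "mask_poly A"] assms
    by (simp add: eval_at_mask_poly k primitive_roots_unity_def)
qed

text \<open>If the mask polynomial vanishes at all primitive \<open>d\<close>-th roots, so does its remainder modulo the monic polynomial
\<open>\<Phi>\<^sub>d\<close>, which then has more roots than its degree allows.\<close>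

lemma cyclotomic_dvd_mask_poly_iff:
  assumes "d > 0"
  shows "cyclotomic d dvd mask_poly A \<longleftrightarrow> vanishes d A"
proof
  let ?R = "primitive_roots_unity d"
  have eval: "eval_at z (cyclotomic d) = 0" if "z \<in> ?R" for z
    unfolding eval_at_def cyclotomic_poly[OF assms] poly_prod
    using that finite_primitive_roots_unity[OF assms] by (auto intro!: prod_zero)
  {
    assume "cyclotomic d dvd mask_poly A"
    then obtain Q where "mask_poly A = cyclotomic d * Q" by (auto elim: dvdE)
    hence "eval_at z (mask_poly A) = 0" if "z \<in> ?R" for z using eval[OF that] by simp
    thus "vanishes d A" by (simp add: vanishes_def eval_at_mask_poly)
  next
    assume A: "vanishes d A"
    have deg: "degree (map_poly complex_of_int P) = degree P" for P
      by (rule degree_map_poly) auto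
    have degC: "degree (cyclotomic d) = card ?R"
      unfolding deg[symmetric] cyclotomic_poly[OF assms]
      by (subst degree_prod_eq_sum_degree) auto
    have "lead_coeff (map_poly complex_of_int (cyclotomic d)) = 1"
      unfolding cyclotomic_poly[OF assms] by (simp add: lead_coeff_prod)
    hence lead: "lead_coeff (cyclotomic d) = 1" by (simp add: deg coeff_map_poly)
    obtain Q R where QR: "pseudo_divmod (mask_poly A) (cyclotomic d) = (Q, R)" by fastforce
    have eq: "mask_poly A = cyclotomic d * Q + R"
      and degR: "R = 0 \<or> degree R < degree (cyclotomic d)"
      using pseudo_divmod[OF _ QR] lead by (metis leading_coeff_0_iff mult.left_neutral power_one smult_1_left zero_neq_one)+
    have R: "eval_at z R = 0" if "z \<in> ?R" for z
    proof -
      have "eval_at z (mask_poly A) = 0" using A that by (simp add: vanishes_def eval_at_mask_poly)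
      thus ?thesis unfolding eq using eval[OF that] by simp
    qed
    have "R = 0"
    proof (rule ccontr)
      assume "R \<noteq> 0"
      hence nz: "map_poly complex_of_int R \<noteq> 0" using map_poly_of_int_eq_iff[of R 0] by simp
      have "card ?R \<le> card {z. poly (map_poly complex_of_int R) z = 0}"
        by (rule card_mono[OF poly_roots_finite[OF nz]]) (use R in \<open>auto simp: eval_at_def\<close>)
      also have "\<dots> \<le> degree R" using card_poly_roots_bound[OF nz] by (simp add: deg)
      finally show False using degR degC \<open>R \<noteq> 0\<close> by simp
    qed
    thus "cyclotomic d dvd mask_poly A" using eq by simp
  }
qed

text \<open>Differentiate \<open>(X - 1) \<Phi>\<^sub>p = X\<^sup>p - 1\<close> at 1.\<close>

lemma poly_cyclotomic_prime_1:
  assumes p: "prime p"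
  shows "poly (cyclotomic p) 1 = int p"
proof -
  have p0: "p > 0" using prime_gt_0_nat[OF p] .
  have "{d. d dvd p} = {1, p}" using p by (auto simp: prime_nat_iff)
  moreover have "primitive_roots_unity 1 = {1}" by (auto simp: primitive_roots_unity_def)
  ultimately have "map_poly complex_of_int ([:-1, 1:] * cyclotomic p) = monom 1 p - 1"
    using prod_primitive_roots_unity[OF p0] prime_gt_1_nat[OF p]
    unfolding map_poly_of_int_mult cyclotomic_poly[OF p0] by (simp add: map_poly_pCons)
  also have "monom 1 p - 1 = map_poly complex_of_int (monom 1 p - 1)"
    by (rule poly_eqI) (simp add: coeff_map_poly)
  finally have "[:-1, 1:] * cyclotomic p = monom 1 p - 1"
    by (simp only: map_poly_of_int_eq_iff)
  hence "poly (pderiv ([:-1, 1:] * cyclotomic p)) 1 = poly (pderiv (monom 1 p - 1)) (1 :: int)"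
    by (simp only:)
  thus ?thesis by (simp add: pderiv_mult pderiv_diff pderiv_monom poly_monom pderiv_pCons)
qed

section \<open>Finite Fourier analysis of residue classes\<close>

text \<open>Linear combinations of the characters \<open>a \<mapsto> z\<^sup>a\<close> with \<open>z\<close> in \<open>S\<close>. If the character sums of \<open>A\<close> vanish on
\<open>S\<close>, every such combination sums to zero over \<open>A\<close>, which is how vanishing is turned into counting.\<close>

definition char_span :: "complex set \<Rightarrow> (nat \<Rightarrow> complex) \<Rightarrow> bool" where
  "char_span S f \<longleftrightarrow> (\<exists>c. \<forall>a. f a = (\<Sum>z\<in>S. c z * z ^ a))"

lemma char_span_mult:
  assumes fin: "finite S1" "finite S2" "finite S"
    and S: "\<And>z w. z \<in> S1 \<Longrightarrow> w \<in> S2 \<Longrightarrow> z * w \<in> S"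
    and f: "char_span S1 f" and g: "char_span S2 g"
  shows "char_span S (\<lambda>a. f a * g a)"
proof -
  obtain c where c: "\<And>a. f a = (\<Sum>z\<in>S1. c z * z ^ a)" using f by (auto simp: char_span_def)
  obtain e where e: "\<And>a. g a = (\<Sum>w\<in>S2. e w * w ^ a)" using g by (auto simp: char_span_def)
  define h where "h v = (\<Sum>(z, w) | (z, w) \<in> S1 \<times> S2 \<and> z * w = v. c z * e w)" for v
  have "f a * g a = (\<Sum>v\<in>S. h v * v ^ a)" for a
  proof -
    have "f a * g a = (\<Sum>(z, w)\<in>S1 \<times> S2. (c z * z ^ a) * (e w * w ^ a))"
      by (simp add: c e sum_product sum.cartesian_product)
    also have "\<dots> = (\<Sum>v\<in>S. \<Sum>x | x \<in> S1 \<times> S2 \<and> fst x * snd x = v.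
        (case x of (z, w) \<Rightarrow> (c z * z ^ a) * (e w * w ^ a)))"
      by (rule sum.group[symmetric]) (use fin S in auto)
    also have "\<dots> = (\<Sum>v\<in>S. h v * v ^ a)"
      unfolding h_def sum_distrib_right
      by (intro sum.cong refl) (auto simp: power_mult_distrib algebra_simps)
    finally show ?thesis .
  qed
  thus ?thesis by (auto simp: char_span_def)
qed

lemma sum_char_span_eq_0:
  assumes "\<And>z. z \<in> S \<Longrightarrow> (\<Sum>a\<in>A. z ^ a) = 0" "char_span S f"
  shows "(\<Sum>a\<in>A. f a) = 0"
proof -
  obtain c where c: "\<And>a. f a = (\<Sum>z\<in>S. c z * z ^ a)" using assms(2) by (auto simp: char_span_def)
  have "(\<Sum>a\<in>A. f a) = (\<Sum>z\<in>S. c z * (\<Sum>a\<in>A. z ^ a))"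
    unfolding c sum_distrib_left by (rule sum.swap)
  thus ?thesis using assms(1) by simp
qed

text \<open>Multiplication by a primitive root permutes the roots of unity and multiplies the sum by a factor, which differs
from 1 unless \<open>m\<close> divides \<open>k\<close>.\<close>

lemma sum_roots_unity_power:
  assumes "m > 0"
  shows "(\<Sum>z::complex | z ^ m = 1. z ^ k) = (if m dvd k then of_nat m else 0)"
proof (cases "m dvd k")
  case True
  hence "z ^ k = 1" if "z ^ m = 1" for z :: complex
    using that by (auto elim!: dvdE simp: power_mult)
  with True show ?thesis using card_roots_unity_eq[OF assms] by simp
next
  case False
  let ?w = "\<omega> m" and ?U = "{z::complex. z ^ m = 1}"
  have w: "?w ^ j = 1 \<longleftrightarrow> m dvd j" for j
    using omega_primitive[OF assms] assms by (simp add: mem_primitive_roots_unity_iff)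
  have "bij_betw (\<lambda>z. z * ?w) ?U ?U"
    using w[of m] omega_nonzero[of m]
    by (intro bij_betwI[where g = "\<lambda>z. z / ?w"]) (auto simp: power_mult_distrib power_divide)
  hence "(\<Sum>z\<in>?U. z ^ k) = (\<Sum>z\<in>?U. (z * ?w) ^ k)"
    by (rule sum.reindex_bij_betw[symmetric])
  also have "\<dots> = (\<Sum>z\<in>?U. z ^ k) * ?w ^ k"
    by (simp add: power_mult_distrib sum_distrib_right)
  finally show ?thesis using w[of k] False by simp
qed

text \<open>The indicator of a residue class has Fourier coefficient \<open>1 / m\<close> at the trivial character, so this coefficient
cancels in a difference of two such indicators.\<close>

lemma char_span_residue_diff:
  assumes "x < m" "y < m"
  shows "char_span ({z. z ^ m = 1} - {1}) (\<lambda>a. of_bool (a mod m = x) - of_bool (a mod m = y))"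
proof -
  have m: "m > 0" using assms by simp
  let ?U = "{z::complex. z ^ m = 1}"
  have ind: "of_bool (a mod m = x) = (\<Sum>z\<in>?U. z ^ (m - x) / of_nat m * z ^ a)" if "x < m" for a x
  proof -
    have "m dvd (m - x) + a \<longleftrightarrow> a mod m = x"
    proof -
      have "m dvd (m - x) + a \<longleftrightarrow> [(m - x) + a + x = 0 + x] (mod m)"
        by (simp only: cong_add_rcancel_nat) (simp add: cong_0_iff)
      also have "(m - x) + a + x = a + m" using that by simp
      also have "[a + m = 0 + x] (mod m) \<longleftrightarrow> a mod m = x" using that by (simp add: cong_def)
      finally show ?thesis .
    qed
    hence "of_bool (a mod m = x) = (\<Sum>z\<in>?U. z ^ ((m - x) + a)) / of_nat m"
      using sum_roots_unity_power[OF m, of "(m - x) + a"] m by simp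
    thus ?thesis by (simp add: power_add sum_divide_distrib)
  qed
  define c where "c z = z ^ (m - x) / of_nat m - z ^ (m - y) / (of_nat m :: complex)" for z
  have "of_bool (a mod m = x) - of_bool (a mod m = y) = (\<Sum>z\<in>?U. c z * z ^ a)" for a
    unfolding ind[OF assms(1)] ind[OF assms(2)] c_def
    by (simp add: sum_subtractf left_diff_distrib)
  also have "(\<Sum>z\<in>?U. c z * z ^ a) = (\<Sum>z\<in>?U - {1}. c z * z ^ a)" for a
    by (rule sum.mono_neutral_right) (use m finite_roots_unity in \<open>auto simp: c_def\<close>)
  finally show ?thesis unfolding char_span_def by blast
qed

definition residue_count :: "nat \<Rightarrow> nat set \<Rightarrow> nat \<Rightarrow> nat" where
  "residue_count m A x = card {a \<in> A. a mod m = x}"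

lemma sum_of_bool_eq_card:
  assumes "finite A"
  shows "(\<Sum>a\<in>A. of_bool (P a)) = (of_nat (card {a \<in> A. P a}) :: 'a :: semiring_1)"
  using assms by (simp add: of_bool_def sum.If_cases Int_def)

lemma sum_residue_count:
  assumes "finite A" "m > 0"
  shows "(\<Sum>x<m. residue_count m A x) = card A"
proof -
  have "card A = (\<Sum>a\<in>A. 1)" by simp
  also have "\<dots> = (\<Sum>x<m. \<Sum>a | a \<in> A \<and> a mod m = x. 1)"
    by (rule sum.group[symmetric]) (use assms in auto)
  finally show ?thesis by (simp add: residue_count_def)
qed

text \<open>The non-trivial characters modulo \<open>m\<close> span the differences of class indicators; conversely, equal class sizes
turn the character sum into a multiple of a geometric sum over a full period.\<close>

lemma equidistributed_iff:
  assumes fin: "finite A" and m: "m > 0"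
  shows "(\<forall>z. z ^ m = 1 \<and> z \<noteq> 1 \<longrightarrow> (\<Sum>a\<in>A. z ^ a) = (0::complex)) \<longleftrightarrow>
    (\<forall>x<m. \<forall>y<m. residue_count m A x = residue_count m A y)" (is "?L \<longleftrightarrow> ?R")
proof
  assume L: ?L
  show ?R
  proof (intro allI impI)
    fix x y assume xy: "x < m" "y < m"
    have "(\<Sum>a\<in>A. of_bool (a mod m = x) - of_bool (a mod m = y)) = (0::complex)"
      by (rule sum_char_span_eq_0[OF _ char_span_residue_diff[OF xy]]) (use L in auto)
    hence "of_nat (residue_count m A x) = (of_nat (residue_count m A y) :: complex)"
      unfolding sum_subtractf sum_of_bool_eq_card[OF fin] residue_count_def by simp
    thus "residue_count m A x = residue_count m A y" by (simp only: of_nat_eq_iff)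
  qed
next
  assume R: ?R
  show ?L
  proof (intro allI impI)
    fix z :: complex assume z: "z ^ m = 1 \<and> z \<noteq> 1"
    have zmod: "z ^ a = z ^ (a mod m)" for a
    proof -
      have "z ^ a = (z ^ m) ^ (a div m) * z ^ (a mod m)" by (simp flip: power_mult power_add)
      thus ?thesis using z by simp
    qed
    have "(\<Sum>a\<in>A. z ^ a) = (\<Sum>x<m. \<Sum>a | a \<in> A \<and> a mod m = x. z ^ a)"
      by (rule sum.group[symmetric]) (use fin m in auto)
    also have "\<dots> = (\<Sum>x<m. of_nat (residue_count m A 0) * z ^ x)"
    proof (rule sum.cong[OF refl])
      fix x assume "x \<in> {..<m}"
      hence "residue_count m A x = residue_count m A 0" using R m by blast
      moreover have "(\<Sum>a | a \<in> A \<and> a mod m = x. z ^ a) = (\<Sum>a | a \<in> A \<and> a mod m = x. z ^ x)"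
        by (rule sum.cong[OF refl]) (use zmod in auto)
      ultimately show "(\<Sum>a | a \<in> A \<and> a mod m = x. z ^ a) = of_nat (residue_count m A 0) * z ^ x"
        by (simp add: residue_count_def)
    qed
    also have "\<dots> = 0" using z geometric_sum[of z m] by (simp flip: sum_distrib_left)
    finally show "(\<Sum>a\<in>A. z ^ a) = 0" .
  qed
qed

definition transversal :: "nat \<Rightarrow> nat set \<Rightarrow> bool" where
  "transversal m A \<longleftrightarrow> bij_betw (\<lambda>a. a mod m) A {..<m}"

lemma transversal_card: "transversal m A \<Longrightarrow> card A = m"
  unfolding transversal_def using bij_betw_same_card by fastforce

lemma transversal_residue_count:
  assumes "transversal m A" "x < m"
  shows "residue_count m A x = 1"
proof -
  have "x \<in> (\<lambda>a. a mod m) ` A" using assms by (simp add: transversal_def bij_betw_def)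
  then obtain a where a: "a \<in> A" "a mod m = x" by blast
  moreover have "b = a" if "b \<in> A" "b mod m = x" for b
    using assms(1) a that unfolding transversal_def bij_betw_def inj_on_def by metis
  ultimately have "{b \<in> A. b mod m = x} = {a}" by blast
  thus ?thesis by (simp add: residue_count_def)
qed

lemma transversalI_inj:
  assumes "m > 0" "inj_on (\<lambda>a. a mod m) A" "card A = m"
  shows "transversal m A"
proof -
  have "(\<lambda>a. a mod m) ` A \<subseteq> {..<m}" using assms by auto
  moreover have "card ((\<lambda>a. a mod m) ` A) = card {..<m}" using assms by (simp add: card_image)
  ultimately have "(\<lambda>a. a mod m) ` A = {..<m}" by (intro card_subset_eq) auto
  thus ?thesis using assms by (simp add: transversal_def bij_betw_def)
qed

lemma transversalI_surj:
  assumes "finite A" "card A = m" "\<And>x. x < m \<Longrightarrow> \<exists>a\<in>A. a mod m = x"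
  shows "transversal m A"
proof (cases "m = 0")
  case True
  thus ?thesis using assms by (simp add: transversal_def bij_betw_def)
next
  case False
  have "(\<lambda>a. a mod m) ` A = {..<m}" using assms(3) False by force
  moreover from this have "inj_on (\<lambda>a. a mod m) A"
    using assms by (intro eq_card_imp_inj_on) auto
  ultimately show ?thesis by (simp add: transversal_def bij_betw_def)
qed

lemma equidistributed_imp_transversal:
  assumes A: "finite A" "card A = m" "m > 0"
    and "\<And>z. z ^ m = 1 \<Longrightarrow> z \<noteq> 1 \<Longrightarrow> (\<Sum>a\<in>A. z ^ a) = (0::complex)"
  shows "transversal m A"
proof (rule transversalI_surj[OF A(1,2)])
  fix x assume x: "x < m"
  have "\<forall>x<m. \<forall>y<m. residue_count m A x = residue_count m A y"
    using equidistributed_iff[OF A(1,3)] assms(4) by blast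
  hence "residue_count m A y = residue_count m A x" if "y < m" for y using x that by blast
  hence "m * residue_count m A x = (\<Sum>y<m. residue_count m A y)" by simp
  also have "\<dots> = m" using sum_residue_count[OF A(1,3)] A(2) by simp
  finally have "residue_count m A x \<noteq> 0" using A(3) by auto
  hence "{a \<in> A. a mod m = x} \<noteq> {}" unfolding residue_count_def by (metis card.empty)
  thus "\<exists>a\<in>A. a mod m = x" by auto
qed

lemma transversal_sum_eq_0:
  assumes "finite A" "transversal m A" "z ^ m = 1" "z \<noteq> (1::complex)"
  shows "(\<Sum>a\<in>A. z ^ a) = 0"
proof (cases "m = 0")
  case True
  thus ?thesis using assms transversal_card by fastforce
next
  case False
  have "\<forall>x<m. \<forall>y<m. residue_count m A x = residue_count m A y"
    using transversal_residue_count[OF assms(2)] by simp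
  hence "\<forall>z. z ^ m = 1 \<and> z \<noteq> 1 \<longrightarrow> (\<Sum>a\<in>A. z ^ a) = (0::complex)"
    using equidistributed_iff[OF assms(1)] False by blast
  thus ?thesis using assms by blast
qed

section \<open>(T1) and (T2) as a complete residue system\<close>

lemma primepow_factors_squarefree:
  assumes "squarefree (N::nat)"
  shows "primepow_factors N = prime_factors N"
proof -
  have N: "N \<noteq> 0" using assms not_squarefree_0 by metis
  have "multiplicity p N = 1" if "p \<in> prime_factors N" for p
    using assms that squarefree_factorial_semiring'[OF N] by blast
  hence "primepow_factors N = {p ^ k | p k. p \<in> prime_factors N \<and> k \<in> {0<..1}}"
    unfolding primepow_factors_altdef[OF N] by force
  also have "\<dots> = prime_factors N" by (force simp: le_Suc_eq)
  finally show ?thesis .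
qed

lemma prod_prime_factors_squarefree:
  assumes "squarefree (d::nat)"
  shows "\<Prod>(prime_factors d) = d"
proof -
  have d: "d \<noteq> 0" using assms not_squarefree_0 by metis
  have "d = (\<Prod>p\<in>prime_factors d. p ^ multiplicity p d)"
    using prime_factorization_nat d by simp
  also have "\<dots> = (\<Prod>p\<in>prime_factors d. p)"
    by (rule prod.cong[OF refl]) (use assms squarefree_factorial_semiring'[OF d] in simp)
  finally show ?thesis by simp
qed

lemma primitive_roots_unity_prime:
  assumes s: "prime s"
  shows "primitive_roots_unity s = {z. z ^ s = 1} - {1}"
proof (intro equalityI subsetI)
  fix z assume z: "z \<in> primitive_roots_unity s"
  show "z \<in> {z. z ^ s = 1} - {1}"
    using z prime_gt_1_nat[OF s] unfolding primitive_roots_unity_def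
    by (auto dest: spec[of _ 1])
next
  fix z :: complex assume z: "z \<in> {z. z ^ s = 1} - {1}"
  then obtain d where d: "d dvd s" "z \<in> primitive_roots_unity d"
    using roots_unity_partition[OF prime_gt_0_nat[OF s]] by blast
  have "d \<noteq> 1" using d(2) z by (auto simp: primitive_roots_unity_def)
  hence "d = s" using d(1) s unfolding prime_nat_iff by blast
  thus "z \<in> primitive_roots_unity s" using d by simp
qed

lemma vanishes_prime_iff:
  assumes A: "finite A" and s: "prime s"
  shows "vanishes s A \<longleftrightarrow> (\<forall>x<s. \<forall>y<s. residue_count s A x = residue_count s A y)"
  unfolding vanishes_def primitive_roots_unity_prime[OF s]
    equidistributed_iff[OF A prime_gt_0_nat[OF s], symmetric] by blast

lemma vanishes_prime_imp_dvd_card: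
  assumes A: "finite A" and s: "prime s" "vanishes s A"
  shows "s dvd card A"
proof -
  have s0: "s > 0" using prime_gt_0_nat[OF s(1)] .
  have "residue_count s A x = residue_count s A 0" if "x < s" for x
    using s(2) that s0 unfolding vanishes_prime_iff[OF A s(1)] by blast
  hence "(\<Sum>x<s. residue_count s A x) = (\<Sum>x<s. residue_count s A 0)"
    by (intro sum.cong refl) (metis lessThan_iff)
  hence "card A = s * residue_count s A 0"
    unfolding sum_residue_count[OF A s0] by simp
  thus ?thesis by simp
qed

lemma vanishes_prime_imp_transversal:
  assumes A: "finite A" "card A = s" and s: "prime s" "vanishes s A"
  shows "transversal s A"
  by (rule equidistributed_imp_transversal[OF A prime_gt_0_nat[OF s(1)]])
    (use s in \<open>auto simp: vanishes_def primitive_roots_unity_prime\<close>)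

lemma transversal_imp_vanishes:
  assumes A: "finite A" "transversal M A" and d: "d dvd M" "d \<noteq> 1"
  shows "vanishes d A"
  unfolding vanishes_def
proof
  fix z assume z: "z \<in> primitive_roots_unity d"
  hence "z \<noteq> 1 \<or> d = 0" using d(2) unfolding primitive_roots_unity_def
    by (cases "d > 1") (auto dest: spec[of _ 1])
  moreover have "z ^ M = 1"
    using z d(1) by (auto simp: primitive_roots_unity_def power_mult elim!: dvdE)
  moreover have "A = {}" if "d = 0"
    using d(1) that transversal_card[OF A(2)] A(1) by simp
  ultimately show "(\<Sum>a\<in>A. z ^ a) = 0"
    using transversal_sum_eq_0[OF A, of z] by (cases "A = {}") auto
qed

text \<open>For squarefree \<open>N\<close> the relevant prime powers are primes, and every divisor \<open>d > 1\<close> of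
their product \<open>M\<close> is the product of a nonempty set of them. So (T2) says that \<open>A\<close> vanishes at all \<open>M\<close>-th roots of unity
other than 1, and (T1) that \<open>card A = M\<close>. For a complete system of residues modulo \<open>M\<close>, a prime
\<open>s\<close> with \<open>\<Phi>\<^sub>s\<close> dividing the mask polynomial divides \<open>card A = M\<close>, so these primes are exactly the prime factors
of \<open>M\<close>.\<close>

lemma T1_T2_iff_transversal:
  assumes N: "squarefree N" and A: "finite A" "A \<noteq> {}"
  shows "T1 N A \<and> T2 N A \<longleftrightarrow> (\<exists>M. M dvd N \<and> transversal M A)"
proof
  let ?S = "cyclotomic_prime_powers N A"
  have S: "?S = {s \<in> prime_factors N. vanishes s A}"
    unfolding cyclotomic_prime_powers_def primepow_factors_squarefree[OF N]
    using cyclotomic_dvd_mask_poly_iff by (auto simp: in_prime_factors_iff prime_gt_0_nat)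
  have finS: "finite ?S" by (simp add: S)
  have primeS: "prime s" if "s \<in> ?S" for s using that by (auto simp: S in_prime_factors_iff)
  have prodS: "(\<Prod>s\<in>?S. poly (cyclotomic s) 1) = int (\<Prod>?S)"
    unfolding of_nat_prod by (rule prod.cong[OF refl]) (simp add: poly_cyclotomic_prime_1 primeS)
  {
    assume T: "T1 N A \<and> T2 N A"
    define M where "M = \<Prod>?S"
    have card: "card A = M" using T prodS unfolding T1_def M_def by (simp only: of_nat_eq_iff)
    have M0: "M > 0" using card A by (metis card_gt_0_iff)
    have M: "M dvd N"
    proof -
      have "M dvd \<Prod>(prime_factors N)" unfolding M_def S by (rule prod_dvd_prod_subset) auto
      thus ?thesis by (simp add: prod_prime_factors_squarefree[OF N])
    qed
    have "(\<Sum>a\<in>A. z ^ a) = 0" if z: "z ^ M = 1" "z \<noteq> (1::complex)" for z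
    proof -
      obtain d where d: "d dvd M" "z \<in> primitive_roots_unity d"
        using roots_unity_partition[OF M0] z by blast
      have d0: "d > 0" using d M0 by (auto intro: Nat.gr0I)
      have "d \<noteq> 1" using d(2) z(2) by (auto simp: primitive_roots_unity_def)
      have "squarefree d" using squarefree_mono[OF dvd_trans[OF d(1) M] N] .
      have sub: "prime_factors d \<subseteq> ?S"
      proof
        fix s assume s: "s \<in> prime_factors d"
        hence "prime s" "s dvd \<Prod>?S"
          using d(1) unfolding M_def by (auto simp: in_prime_factors_iff intro: dvd_trans)
        then obtain t where "t \<in> ?S" "s dvd t"
          using prime_dvd_prod_iff[OF finS, of s "\<lambda>x. x"] by auto
        thus "s \<in> ?S" using \<open>prime s\<close> primeS primes_dvd_imp_eq by blast
      qed
      have "prime_factors d \<noteq> {}" using \<open>d \<noteq> 1\<close> d0 by (simp add: prime_factorization_empty_iff)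
      moreover have "inj_on aprimedivisor (prime_factors d)"
        by (rule inj_onI) (auto simp: in_prime_factors_iff)
      ultimately have "cyclotomic (\<Prod>(prime_factors d)) dvd mask_poly A"
        using T sub unfolding T2_def by blast
      hence "vanishes d A"
        by (simp add: prod_prime_factors_squarefree[OF \<open>squarefree d\<close>] cyclotomic_dvd_mask_poly_iff[OF d0])
      thus ?thesis using d(2) by (simp add: vanishes_def)
    qed
    hence "transversal M A" by (rule equidistributed_imp_transversal[OF A(1) card M0])
    thus "\<exists>M. M dvd N \<and> transversal M A" using M by blast
  next
    assume "\<exists>M. M dvd N \<and> transversal M A"
    then obtain M where M: "M dvd N" "transversal M A" by blast
    have card: "card A = M" using transversal_card[OF M(2)] .
    have M0: "M > 0" using card A by (metis card_gt_0_iff)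
    have sqM: "squarefree M" using squarefree_mono[OF M(1) N] .
    have van: "vanishes d A" if d: "d dvd M" "d \<noteq> 1" for d
      by (rule transversal_imp_vanishes[OF A(1) M(2) d])
    have "?S = prime_factors M"
    proof (intro equalityI subsetI)
      fix s assume s: "s \<in> ?S"
      have ps: "prime s" and vs: "vanishes s A" using s by (auto simp: S in_prime_factors_iff)
      have "s dvd M" using vanishes_prime_imp_dvd_card[OF A(1) ps vs] card by simp
      thus "s \<in> prime_factors M" using ps M0 by (simp add: in_prime_factors_iff)
    next
      fix s assume "s \<in> prime_factors M"
      hence "prime s" "s dvd M" by (auto simp: in_prime_factors_iff)
      moreover have "N \<noteq> 0" using N not_squarefree_0 by metis
      moreover have "s \<noteq> 1" using \<open>prime s\<close> by auto
      ultimately show "s \<in> ?S" using van M(1)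
        by (auto simp: S in_prime_factors_iff intro: dvd_trans)
    qed
    hence "\<Prod>?S = M" using prod_prime_factors_squarefree[OF sqM] by simp
    hence "T1 N A" unfolding T1_def prodS by (simp add: card)
    moreover have "T2 N A" unfolding T2_def
    proof (intro allI impI)
      fix F assume F: "finite F \<and> F \<noteq> {} \<and> F \<subseteq> ?S \<and> inj_on aprimedivisor F"
      have "\<Prod>F dvd \<Prod>?S" by (rule prod_dvd_prod_subset) (use F finS in auto)
      hence dvd: "\<Prod>F dvd M" by (simp add: \<open>\<Prod>?S = M\<close>)
      obtain s where "s \<in> F" using F by blast
      hence "s dvd \<Prod>F" "prime s" using F primeS by (auto intro: dvd_prodI)
      hence "\<Prod>F \<noteq> 1" using not_prime_unit by auto
      hence "vanishes (\<Prod>F) A" using van dvd by blast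
      moreover have "\<Prod>F > 0" using dvd M0 by (auto intro!: Nat.gr0I)
      ultimately show "cyclotomic (\<Prod>F) dvd mask_poly A"
        by (simp add: cyclotomic_dvd_mask_poly_iff)
    qed
    ultimately show "T1 N A \<and> T2 N A" ..
  }
qed


section \<open>Complete residue systems tile and are spectral\<close>

lemma transversal_imp_tiles:
  assumes N: "N > 0" "M dvd N" and A: "transversal M A"
  shows "tiles N A"
proof -
  obtain K where K: "N = M * K" using N(2) by (auto elim: dvdE)
  have MK: "M > 0" "K > 0" using K N(1) by auto
  have inj: "inj_on (\<lambda>a. a mod M) A" and surj: "(\<lambda>a. a mod M) ` A = {..<M}"
    using A by (auto simp: transversal_def bij_betw_def)
  define T where "T = (\<lambda>j. M * j) ` {..<K}"
  have modM: "(a + t) mod N mod M = a mod M" if "t \<in> T" for a t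
    using that by (auto simp: T_def K mod_mult2_eq)
  have "T \<subseteq> {..<N}" using MK by (auto simp: T_def K)
  moreover have "disjoint_family_on (translate N A) T"
    unfolding disjoint_family_on_def
  proof (intro ballI impI)
    fix t t' assume t: "t \<in> T" "t' \<in> T" "t \<noteq> t'"
    have False if ab: "a \<in> A" "b \<in> A" and eq: "(a + t) mod N = (b + t') mod N" for a b
    proof -
      have "a mod M = b mod M" using modM t eq by metis
      hence "a = b" using inj ab by (auto dest: inj_onD)
      hence "[a + t = a + t'] (mod N)" using eq by (simp add: cong_def)
      hence "[t = t'] (mod N)" by (simp only: cong_add_lcancel_nat)
      moreover have "t < N" "t' < N" using t \<open>T \<subseteq> {..<N}\<close> by auto
      ultimately show False using t(3) by (simp add: cong_def)
    qed
    thus "translate N A t \<inter> translate N A t' = {}" unfolding translate_def by blast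
  qed
  moreover have "(\<Union>t\<in>T. translate N A t) = {..<N}"
  proof (intro equalityI subsetI)
    fix x assume x: "x \<in> {..<N}"
    have "x mod M \<in> (\<lambda>a. a mod M) ` A" using MK by (simp add: surj)
    then obtain a where a: "a \<in> A" "x mod M = a mod M" by blast
    have "(x + a * N) mod M = a mod M" unfolding a(2)[symmetric] K
      by (metis mod_mult_self2 mult.assoc mult.commute)
    hence "[x + a * N = a] (mod M)" by (simp add: cong_def)
    moreover have le: "a \<le> x + a * N" using N(1) by (intro trans_le_add2) (cases N, auto)
    ultimately have "M dvd x + a * N - a" by (metis cong_altdef_nat)
    then obtain j where j: "x + a * N - a = M * j" by (rule dvdE)
    have "a + M * (j mod K) = a + M * j mod N" by (simp only: K mult_mod_right)
    hence "(a + M * (j mod K)) mod N = (a + M * j) mod N" by (simp only: mod_add_right_eq)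
    also have "a + M * j = x + a * N" using j le by simp
    also have "(x + a * N) mod N = x" using x by simp
    finally have "x \<in> translate N A (M * (j mod K))" using a(1) unfolding translate_def by force
    moreover have "M * (j mod K) \<in> T" using MK by (auto simp: T_def)
    ultimately show "x \<in> (\<Union>t\<in>T. translate N A t)" by blast
  qed (use N(1) in \<open>auto simp: translate_def\<close>)
  ultimately show ?thesis unfolding tiles_def by blast
qed

lemma omega_powi_power:
  "\<omega> N powi ((int b - int b') * int a) = (\<omega> N powi (int b - int b')) ^ a"
  by (simp add: power_int_mult)

lemma transversal_imp_spectral:
  assumes N: "N > 0" "M dvd N" and A: "finite A" "A \<noteq> {}" "transversal M A"
  shows "spectral N A"
proof -
  obtain K where K: "N = M * K" using N(2) by (auto elim: dvdE)
  have MK: "M > 0" "K > 0" using K N(1) by auto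
  have w: "\<omega> N ^ m = 1 \<longleftrightarrow> N dvd m" for m
    using omega_primitive[OF N(1)] N(1) by (simp add: mem_primitive_roots_unity_iff)
  define B where "B = (\<lambda>j. K * j) ` {..<M}"
  have "B \<subseteq> {..<N}" using MK by (auto simp: B_def K mult.commute)
  moreover have "card B = card A"
    unfolding B_def transversal_card[OF A(3)] using MK by (subst card_image) (auto simp: inj_on_def)
  moreover have "(\<Sum>a\<in>A. \<omega> N powi ((int b - int b') * int a)) = 0"
    if b: "b \<in> B" "b' \<in> B" "b \<noteq> b'" for b b'
  proof -
    obtain j j' where j: "b = K * j" "b' = K * j'" "j < M" "j' < M"
      using b by (auto simp: B_def)
    let ?z = "\<omega> N powi (int b - int b')"
    have z: "?z = \<omega> N ^ b / \<omega> N ^ b'"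
      using omega_nonzero by (simp add: power_int_diff)
    have "?z ^ M = 1"
    proof -
      have "(\<omega> N ^ b) ^ M = 1" "(\<omega> N ^ b') ^ M = 1"
        unfolding power_mult[symmetric] w by (simp_all add: j K)
      thus ?thesis by (simp add: z power_divide)
    qed
    moreover have "?z \<noteq> 1"
    proof
      assume "?z = 1"
      hence eq: "\<omega> N ^ b = \<omega> N ^ b'" using z omega_nonzero by (simp add: field_simps)
      have *: "\<not> (x < y \<and> y < N \<and> \<omega> N ^ x = \<omega> N ^ y)" for x y
      proof
        assume xy: "x < y \<and> y < N \<and> \<omega> N ^ x = \<omega> N ^ y"
        have "\<omega> N ^ x * \<omega> N ^ (y - x) = \<omega> N ^ y" unfolding power_add[symmetric] using xy by simp
        hence "\<omega> N ^ (y - x) = 1" using xy omega_nonzero by simp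
        thus False using xy w by (auto dest: dvd_imp_le)
      qed
      show False using *[of b b'] *[of b' b] eq b \<open>B \<subseteq> {..<N}\<close> by (cases "b < b'") auto
    qed
    ultimately show ?thesis
      unfolding omega_powi_power by (intro transversal_sum_eq_0[OF A(1,3)])
  qed
  ultimately show ?thesis unfolding spectral_iff[OF A(1,2)] by metis
qed

section \<open>Tiles of squarefree period are complete residue systems\<close>

text \<open>Together with \<open>card A * card T = N\<close> this says that \<open>T\<close> is a tiling complement of \<open>A\<close>. The elements of \<open>T\<close> are
arbitrary naturals, so that passing from \<open>T\<close> to \<open>k T\<close> is a plain image, of the same size.\<close>

definition covers :: "nat \<Rightarrow> nat set \<Rightarrow> nat set \<Rightarrow> bool" where
  "covers N A T \<longleftrightarrow> (\<forall>x. \<exists>a\<in>A. \<exists>t\<in>T. [a + t = x] (mod N))"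

lemma dvd_power_minus_one: "x - 1 dvd x ^ k - (1 :: 'a :: comm_ring_1)"
  by (simp add: power_diff_1_eq)

lemma mask_poly_product:
  assumes "finite A" "finite T"
  shows "mask_poly A * mask_poly T = (\<Sum>(a, t)\<in>A \<times> T. monom 1 (a + t))"
  by (simp add: mask_poly_def sum_product sum.cartesian_product mult_monom)

text \<open>A covering with \<open>card A * card T = N\<close> hits every residue class exactly once, and
\<open>X\<^sup>i\<close> is congruent to \<open>X\<close> to the power \<open>i mod N\<close> modulo \<open>X\<^sup>N - 1\<close>.\<close>

lemma covers_imp_mask_poly_dvd:
  assumes fin: "finite A" "finite T" and card: "card A * card T = N" and N: "N > 0"
    and cov: "covers N A T"
  shows "monom 1 N - 1 dvd mask_poly A * mask_poly T - (\<Sum>i<N. monom 1 i)"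
proof -
  let ?f = "\<lambda>(a, t). (a + t) mod N"
  have im: "?f ` (A \<times> T) = {..<N}"
  proof (intro equalityI subsetI)
    fix x assume "x \<in> {..<N}"
    moreover obtain a t where "a \<in> A" "t \<in> T" "[a + t = x] (mod N)"
      using cov unfolding covers_def by blast
    ultimately show "x \<in> ?f ` (A \<times> T)" by (force simp: cong_def)
  qed (use N in auto)
  hence inj: "inj_on ?f (A \<times> T)"
    using fin card by (intro eq_card_imp_inj_on) (auto simp: card_cartesian_product)
  have "(\<Sum>i<N. monom 1 i) = (\<Sum>x\<in>A \<times> T. monom (1::int) (?f x))"
    unfolding im[symmetric] by (simp add: sum.reindex[OF inj])
  hence "mask_poly A * mask_poly T - (\<Sum>i<N. monom 1 i) =
      (\<Sum>x\<in>A \<times> T. monom 1 (fst x + snd x) - monom 1 ((fst x + snd x) mod N))"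
    unfolding mask_poly_product[OF fin] sum_subtractf by (simp add: case_prod_unfold)
  moreover have "monom 1 N - 1 dvd monom 1 i - monom (1::int) (i mod N)" for i
  proof -
    have "monom (1::int) i = monom 1 (i mod N) * monom 1 N ^ (i div N)"
      by (simp add: monom_power mult_monom)
    hence "monom 1 i - monom (1::int) (i mod N) = monom 1 (i mod N) * (monom 1 N ^ (i div N) - 1)"
      by (simp add: right_diff_distrib)
    thus ?thesis using dvd_power_minus_one by (metis dvd_mult)
  qed
  ultimately show ?thesis by (simp only: dvd_sum)
qed

text \<open>Write \<open>J = 1 + X + \<dots> + X\<^sup>N\<^sup>-\<^sup>1\<close> and \<open>c = card T\<close>. Modulo \<open>X\<^sup>N - 1\<close> the tiling gives
\<open>A(X) T(X) = J\<close>, and \<open>J T(X) = c J\<close>, so \<open>A(X) T(X)\<^sup>l = c\<^sup>l\<^sup>-\<^sup>1 J\<close>. Since \<open>T(X)\<^sup>l\<close> is congruent to \<open>T(X\<^sup>l)\<close> modulo \<open>l\<close>, the number of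
representations of a residue as \<open>a + l t\<close> is congruent to \<open>c\<^sup>l\<^sup>-\<^sup>1\<close> modulo \<open>l\<close>, and so cannot be zero.\<close>

lemma covers_mult_prime:
  assumes fin: "finite A" "finite T" and card: "card A * card T = N" and N: "N > 0"
    and cov: "covers N A T" and l: "prime l" "\<not> l dvd card T"
  shows "covers N A ((*) l ` T)"
proof (rule ccontr)
  assume "\<not> covers N A ((*) l ` T)"
  then obtain x0 where x0: "\<not> [a + l * t = x0] (mod N)" if "a \<in> A" "t \<in> T" for a t
    unfolding covers_def by blast
  define x where "x = x0 mod N"
  have x: "x < N" using N by (simp add: x_def)
  have nox: "a + l * t \<noteq> x + j * N" if "a \<in> A" "t \<in> T" for a t j
  proof
    assume "a + l * t = x + j * N"
    hence "[a + l * t = x0] (mod N)" by (simp add: cong_def x_def)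
    thus False using x0 that by blast
  qed
  let ?a = "mask_poly A" and ?t = "mask_poly T" and ?Q = "monom 1 N - 1 :: int poly"
  let ?J = "\<Sum>i<N. monom 1 i :: int poly" and ?c = "int (card T)"
  have l0: "l > 0" using prime_gt_0_nat[OF l(1)] .
  have at: "?Q dvd ?a * ?t - ?J" by (rule covers_imp_mask_poly_dvd[OF fin card N cov])
  have pw: "monom 1 1 ^ i = monom (1::int) i" for i by (simp add: monom_power)
  have QJ: "?Q = (monom 1 1 - 1) * ?J"
    by (rule power_diff_1_eq[of "monom 1 1 :: int poly" N, unfolded pw])
  have "?t - [:?c:] = (\<Sum>t\<in>T. monom 1 1 ^ t - 1)"
    by (simp add: mask_poly_def sum_subtractf monom_power of_nat_poly)
  hence "monom 1 1 - 1 dvd ?t - [:?c:]"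
    by (simp only:) (intro dvd_sum dvd_power_minus_one)
  also have "?t - [:?c:] dvd ?t ^ (l - 1) - [:?c:] ^ (l - 1)"
    by (simp only: power_diff_sumr2 dvd_triv_left)
  finally have "?Q dvd ?J * (?t ^ (l - 1) - [:?c:] ^ (l - 1))"
    unfolding QJ by (simp add: mult.commute mult_dvd_mono)
  moreover have "?Q dvd (?a * ?t - ?J) * ?t ^ (l - 1)" using at by simp
  ultimately have "?Q dvd (?a * ?t - ?J) * ?t ^ (l - 1) + ?J * (?t ^ (l - 1) - [:?c:] ^ (l - 1))"
    by (rule dvd_add[rotated])
  also have "\<dots> = ?a * ?t ^ l - ?J * [:?c:] ^ (l - 1)"
    using power_Suc[of ?t "l - 1"] l0 by (simp add: algebra_simps)
  finally obtain K where K: "?a * ?t ^ l - ?J * [:?c:] ^ (l - 1) = ?Q * K" by (auto elim: dvdE)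
  obtain H where H: "?t ^ l - pcompose ?t (monom 1 l) = [:int l:] * H"
    using power_prime_cong_pcompose[OF l(1), of ?t] by (rule dvdE)
  have pc: "pcompose ?t (monom 1 l) = (\<Sum>t\<in>T. monom 1 (l * t))"
  proof -
    have "pcompose (monom 1 t) (monom 1 l) = monom (1::int) (l * t)" for t
      by (induction t) (simp_all add: monom_Suc pcompose_pCons mult_monom monom_0 pcompose_const)
    thus ?thesis by (simp add: mask_poly_def pcompose_sum)
  qed
  define G where "G = ?a * pcompose ?t (monom 1 l)"
  have G: "G = smult (?c ^ (l - 1)) ?J + ?Q * K - smult (int l) (?a * H)"
  proof -
    have "G = ?a * ?t ^ l - ?a * (?t ^ l - pcompose ?t (monom 1 l))"
      by (simp add: G_def algebra_simps)
    also have "\<dots> = ?J * [:?c:] ^ (l - 1) + ?Q * K - ?a * ([:int l:] * H)"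
      unfolding H K[symmetric] by simp
    finally show ?thesis by (simp add: poly_const_pow mult.commute)
  qed
  have coeffG: "coeff G (x + j * N) = 0" for j
  proof -
    have "G = (\<Sum>a\<in>A. \<Sum>t\<in>T. monom 1 (a + l * t))"
      unfolding G_def pc by (simp add: mask_poly_def sum_product mult_monom)
    thus ?thesis using nox by (simp add: coeff_sum)
  qed
  \<comment> \<open>the sum of the coefficients at exponents congruent to \<open>x\<close>, cut off at \<open>m\<close>; multiples of
    \<open>X\<^sup>N - 1\<close> are killed for large \<open>m\<close> because the sum telescopes\<close>
  define L where "L m F = (\<Sum>j\<le>m. coeff F (x + j * N))" for m and F :: "int poly"
  have LQ: "L m (?Q * K) = - coeff K (x + m * N)" for m
  proof (induction m)
    case 0
    show ?case using x by (simp add: L_def left_diff_distrib coeff_monom_mult)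
  next
    case (Suc m)
    have "L (Suc m) (?Q * K) = L m (?Q * K) + coeff (?Q * K) (x + Suc m * N)"
      by (simp add: L_def)
    also have "coeff (?Q * K) (x + Suc m * N) = coeff K (x + m * N) - coeff K (x + Suc m * N)"
      by (simp add: left_diff_distrib coeff_monom_mult)
    finally show ?case using Suc by simp
  qed
  define m where "m = Suc (degree K)"
  have "degree K < x + m * N"
  proof -
    have "m * 1 \<le> m * N" using N by (intro mult_le_mono2) simp
    thus ?thesis by (simp add: m_def)
  qed
  hence "L m (?Q * K) = 0" using LQ by (simp add: coeff_eq_0)
  moreover have "L m ?J = 1"
  proof -
    have "L m ?J = (\<Sum>j\<le>m. if j = 0 then 1 else 0)"
      unfolding L_def
    proof (rule sum.cong[OF refl])
      fix j assume "j \<in> {..m}"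
      have "x + j * N < N \<longleftrightarrow> j = 0" using x N by (cases j) auto
      thus "coeff ?J (x + j * N) = (if j = 0 then 1 else 0)"
        by (simp add: coeff_sum)
    qed
    thus ?thesis by simp
  qed
  moreover have "L m G = 0" by (simp add: L_def coeffG)
  moreover have "L m G = ?c ^ (l - 1) * L m ?J + L m (?Q * K) - int l * L m (?a * H)"
    unfolding G L_def by (simp add: sum.distrib sum_subtractf sum_distrib_left)
  ultimately have "?c ^ (l - 1) = int l * L m (?a * H)" by simp
  hence "int l dvd int (card T ^ (l - 1))" by simp
  hence "l dvd card T ^ (l - 1)" by (simp only: int_dvd_int_iff)
  thus False using l prime_dvd_power by blast
qed

lemma covers_mult_coprime:
  assumes fin: "finite A" "finite T" and card: "card A * card T = N" and N: "N > 0"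
    and cov: "covers N A T" and k: "k \<noteq> 0" "coprime k (card T)"
  shows "covers N A ((*) k ` T)"
  using k
proof (induction k rule: prime_divisors_induct)
  case (factor l k)
  have k: "k \<noteq> 0" "coprime k (card T)" "coprime l (card T)" using factor.prems by auto
  have "card ((*) k ` T) = card T" using k(1) by (intro card_image) (auto simp: inj_on_def)
  moreover have "\<not> l dvd card T"
    using k(3) factor.hyps by (meson coprime_common_divisor dvd_refl not_prime_unit)
  ultimately have "covers N A ((*) l ` (*) k ` T)"
    using covers_mult_prime[OF fin(1) _ _ N factor.IH[OF k(1,2)] factor.hyps] fin card by simp
  thus ?case by (simp add: image_image mult.assoc)
next
  case (unit u)
  thus ?case using cov by simp
qed simp

text \<open>As \<open>N\<close> is squarefree, \<open>card A\<close> is coprime to the size of the complement \<open>T\<close>, so \<open>card A * T\<close> is a complement as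
well. All translations are then by multiples of \<open>card A\<close>, and every class modulo \<open>card A\<close> must contain an element of
\<open>A\<close>.\<close>

lemma tiles_imp_transversal:
  assumes N: "squarefree N" and A: "A \<subseteq> {..<N}" "A \<noteq> {}" and tile: "tiles N A"
  shows "card A dvd N" "transversal (card A) A"
proof -
  have N0: "N > 0" using N not_squarefree_0 by (metis gr0I)
  have finA: "finite A" using A finite_subset by blast
  obtain T where T: "T \<subseteq> {..<N}" "disjoint_family_on (translate N A) T"
      "(\<Union>t\<in>T. translate N A t) = {..<N}"
    using tile unfolding tiles_def by blast
  have finT: "finite T" using T finite_subset by blast
  have "card (translate N A t) = card A" for t
    unfolding translate_def
  proof (rule card_image, rule inj_onI)
    fix a b assume ab: "a \<in> A" "b \<in> A" "(a + t) mod N = (b + t) mod N"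
    hence "[a + t = b + t] (mod N)" by (simp add: cong_def)
    hence "[a = b] (mod N)" by (simp only: cong_add_rcancel_nat)
    moreover have "a < N" "b < N" using ab A by auto
    ultimately show "a = b" by (simp add: cong_def)
  qed
  moreover have "card (\<Union>t\<in>T. translate N A t) = (\<Sum>t\<in>T. card (translate N A t))"
    using finT T(2) finA
    by (intro card_UN_disjoint) (auto simp: disjoint_family_on_def translate_def)
  ultimately have card: "card A * card T = N" using T(3) by (simp add: mult.commute)
  have cov: "covers N A T" unfolding covers_def
  proof
    fix x
    have "x mod N \<in> (\<Union>t\<in>T. translate N A t)" using T(3) N0 by simp
    then obtain t a where "t \<in> T" "a \<in> A" "x mod N = (a + t) mod N"
      unfolding translate_def by blast
    thus "\<exists>a\<in>A. \<exists>t\<in>T. [a + t = x] (mod N)" unfolding cong_def by metis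
  qed
  have n0: "card A \<noteq> 0" using finA A(2) by simp
  have "coprime (card A) (card T)"
  proof (rule coprimeI)
    fix g assume "g dvd card A" "g dvd card T"
    hence "g ^ 2 dvd N" unfolding card[symmetric] power2_eq_square by (rule mult_dvd_mono)
    thus "is_unit g" using N squarefreeD by blast
  qed
  hence cov': "covers N A ((*) (card A) ` T)"
    by (rule covers_mult_coprime[OF finA finT card N0 cov n0])
  show "card A dvd N" using card by (metis dvd_triv_left)
  show "transversal (card A) A"
  proof (rule transversalI_surj[OF finA refl])
    fix x assume x: "x < card A"
    obtain a t where a: "a \<in> A" "[a + card A * t = x] (mod N)"
      using cov' unfolding covers_def by blast
    hence "[a + card A * t = x] (mod (card A))" using \<open>card A dvd N\<close> cong_dvd_modulus_nat by blast
    hence "a mod card A = x" using x by (simp add: cong_def)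
    thus "\<exists>a\<in>A. a mod card A = x" using a by blast
  qed
qed

section \<open>Spectral pairs and vanishing character sums\<close>

text \<open>Orthogonality in both directions, which makes the notion symmetric in \<open>A\<close> and \<open>B\<close>.\<close>

definition spectral_pair :: "nat \<Rightarrow> nat set \<Rightarrow> nat set \<Rightarrow> bool" where
  "spectral_pair N A B \<longleftrightarrow> A \<subseteq> {..<N} \<and> B \<subseteq> {..<N} \<and> A \<noteq> {} \<and> card A = card B \<and>
     (\<forall>b\<in>B. \<forall>b'\<in>B. b \<noteq> b' \<longrightarrow> (\<Sum>a\<in>A. \<omega> N powi ((int b - int b') * int a)) = 0) \<and>
     (\<forall>a\<in>A. \<forall>a'\<in>A. a \<noteq> a' \<longrightarrow> (\<Sum>b\<in>B. \<omega> N powi ((int a - int a') * int b)) = 0)"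

lemma spectral_pair_sym:
  assumes "spectral_pair N A B"
  shows "spectral_pair N B A"
proof -
  have "finite A" "finite B"
    using assms finite_subset[OF _ finite_lessThan] by (auto simp: spectral_pair_def)
  hence "B \<noteq> {}" using assms by (auto simp: spectral_pair_def)
  thus ?thesis using assms unfolding spectral_pair_def by simp
qed

text \<open>The dual orthogonality comes from completeness: the coefficients of the indicator of a point \<open>a\<close> in the orthogonal
basis are \<open>cnj (\<chi>\<^sub>b(a)) / card A\<close>, and evaluating the expansion at another point \<open>a'\<close> gives the
character sum of \<open>B\<close> at \<open>a' - a\<close>.\<close>

lemma spectral_imp_spectral_pair:
  assumes A: "A \<subseteq> {..<N}" "A \<noteq> {}" and "spectral N A"
  obtains B where "spectral_pair N A B"
proof -
  let ?x = "\<lambda>b x. \<omega> N ^ (b * x)"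
  have finA: "finite A" using A finite_subset by blast
  obtain B where B: "B \<subseteq> {..<N}" and basis: "orthogonal_basis A B ?x"
    using assms(3) unfolding spectral_def by blast
  have finB: "finite B" using B finite_subset by blast
  have card: "card A = card B"
    and orth: "pairwise (\<lambda>b b'. l2_inner A (?x b) (?x b') = 0) B"
    using basis orthogonal_basis_iff_card[OF finA finB A(2), of ?x]
    by (simp_all add: norm_power norm_omega)
  let ?n = "of_nat (card A) :: complex"
  have n0: "?n \<noteq> 0" using finA A(2) by simp
  have inner: "l2_inner A (?x b') (?x b) = (if b' = b then ?n else 0)" if "b \<in> B" "b' \<in> B" for b b'
  proof (cases "b' = b")
    case True
    thus ?thesis by (simp add: l2_inner_characters)
  next
    case False
    thus ?thesis using orth that by (simp add: pairwise_def)
  qed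
  have dual: "(\<Sum>b\<in>B. \<omega> N powi ((int a' - int a) * int b)) = 0"
    if a: "a \<in> A" "a' \<in> A" "a' \<noteq> a" for a a'
  proof -
    obtain c where c: "\<And>x. x \<in> A \<Longrightarrow> (if x = a then 1 else 0) = (\<Sum>b\<in>B. c b * ?x b x)"
      using basis unfolding orthogonal_basis_def
      by (auto dest!: spec[of _ "\<lambda>x. if x = a then 1 else 0"])
    have cb: "cnj (?x b a) = c b * ?n" if b: "b \<in> B" for b
    proof -
      have "cnj (?x b a) = (\<Sum>x\<in>A. (if x = a then 1 else 0) * cnj (?x b x))"
        using a finA by (simp add: if_distrib[of "\<lambda>u. u * _"] cong: if_cong)
      also have "\<dots> = (\<Sum>x\<in>A. \<Sum>b'\<in>B. c b' * (?x b' x * cnj (?x b x)))"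
        by (rule sum.cong[OF refl]) (simp add: c sum_distrib_right mult.assoc)
      also have "\<dots> = (\<Sum>b'\<in>B. c b' * l2_inner A (?x b') (?x b))"
        unfolding l2_inner_def sum_distrib_left by (rule sum.swap)
      also have "\<dots> = (\<Sum>b'\<in>B. if b' = b then c b' * ?n else 0)"
        by (rule sum.cong[OF refl]) (simp add: inner b)
      also have "\<dots> = c b * ?n" using b finB by simp
      finally show ?thesis .
    qed
    have "(\<Sum>b\<in>B. \<omega> N powi ((int a' - int a) * int b)) = (\<Sum>b\<in>B. ?x b a' * cnj (?x b a))"
      using l2_inner_characters[of B N a' a] by (simp add: l2_inner_def mult.commute)
    also have "\<dots> = (\<Sum>b\<in>B. c b * ?x b a') * ?n"
      unfolding sum_distrib_right by (rule sum.cong[OF refl]) (simp only: cb mult_ac)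
    also have "\<dots> = 0" using c[OF a(2)] a(3) by simp
    finally show ?thesis .
  qed
  have "spectral_pair N A B"
    unfolding spectral_pair_def
    using A B card orth dual by (auto simp: pairwise_def l2_inner_characters)
  thus ?thesis by (rule that)
qed

text \<open>The hypotheses say that \<open>a - a'\<close> has additive order \<open>d\<close> modulo \<open>N\<close>, so the orthogonality relation for \<open>a\<close> and
\<open>a'\<close> is the vanishing of the character sum of \<open>B\<close> at a primitive \<open>d\<close>-th root of unity.\<close>

lemma spectral_pair_vanishes:
  assumes sp: "spectral_pair N A B" and N: "N = m * d" "N > 0"
    and a: "a \<in> A" "a' \<in> A" "a mod m = a' mod m"
    and d: "d > 1" "\<And>s. prime s \<Longrightarrow> s dvd d \<Longrightarrow> a mod s \<noteq> a' mod s"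
  shows "vanishes d B"
proof -
  have main: "vanishes d B"
    if c: "c \<in> A" "c' \<in> A" "c mod m = c' mod m" "c' \<le> c"
      "\<And>s. prime s \<Longrightarrow> s dvd d \<Longrightarrow> c mod s \<noteq> c' mod s" for c c'
  proof -
    define u where "u = c - c'"
    have mod_iff: "s dvd u \<longleftrightarrow> c mod s = c' mod s" for s
      using mod_eq_dvd_iff_nat[OF c(4)] by (auto simp: u_def)
    obtain v where v: "u = m * v" using mod_iff[of m] c(3) by blast
    have "coprime v d"
    proof (rule ccontr)
      assume "\<not> coprime v d"
      then obtain s where "prime s" "s dvd v" "s dvd d"
        by (metis coprime_iff_gcd_eq_1 gcd_nat.bounded_iff prime_factor_nat)
      thus False using c(5) mod_iff[of s] v by auto
    qed
    have w: "\<omega> N ^ j = 1 \<longleftrightarrow> N dvd j" for j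
      using omega_primitive[OF N(2)] N(2) by (simp add: mem_primitive_roots_unity_iff)
    have "(\<omega> N ^ u) ^ j = 1 \<longleftrightarrow> d dvd j" for j
    proof -
      have "(\<omega> N ^ u) ^ j = 1 \<longleftrightarrow> N dvd u * j"
        unfolding power_mult[symmetric] by (rule w)
      also have "\<dots> \<longleftrightarrow> m * d dvd m * (v * j)" by (simp only: N(1) v mult.assoc)
      also have "\<dots> \<longleftrightarrow> d dvd v * j" using N by simp
      also have "\<dots> \<longleftrightarrow> d dvd j" using \<open>coprime v d\<close>
        by (simp add: coprime_commute coprime_dvd_mult_right_iff)
      finally show ?thesis .
    qed
    hence prim: "\<omega> N ^ u \<in> primitive_roots_unity d"
      using d(1) by (simp add: mem_primitive_roots_unity_iff)
    have "c \<noteq> c'"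
    proof
      assume "c = c'"
      obtain s where "prime s" "s dvd d" using d(1) prime_factor_nat by (metis less_irrefl)
      thus False using c(5) \<open>c = c'\<close> by blast
    qed
    hence "(\<Sum>b\<in>B. \<omega> N powi ((int c - int c') * int b)) = 0"
      using sp c(1,2) unfolding spectral_pair_def by blast
    moreover have "\<omega> N powi (int c - int c') = \<omega> N ^ u"
      using c(4) by (simp add: u_def flip: of_nat_diff)
    ultimately have "(\<Sum>b\<in>B. (\<omega> N ^ u) ^ b) = 0" by (simp only: omega_powi_power)
    thus ?thesis by (rule vanishesI[rotated 2]) (use d(1) prim in auto)
  qed
  show ?thesis
  proof (cases "a' \<le> a")
    case True
    thus ?thesis using main[of a a'] a d(2) by blast
  next
    case False
    hence "a \<le> a'" by simp
    moreover have "a' mod s \<noteq> a mod s" if "prime s" "s dvd d" for s using d(2)[OF that] by metis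
    ultimately show ?thesis using main[of a' a] a by metis
  qed
qed

lemma mod_prime_mult_eqI:
  fixes a b p q :: nat
  assumes "prime p" "prime q" "p \<noteq> q" "a mod p = b mod p" "a mod q = b mod q"
  shows "a mod (p * q) = b mod (p * q)"
  using coprime_cong_mult_nat[of a b p q] primes_coprime[of p q] assms by (simp add: cong_def)

text \<open>The summand is a product of two differences of class indicators, modulo \<open>q\<close> and modulo \<open>r\<close>. Such differences
involve only primitive \<open>q\<close>-th and \<open>r\<close>-th roots, so the product involves only primitive roots of order \<open>q r\<close>.
In coordinates, the alternating sum over the corners of a rectangle is zero.\<close>

lemma vanishes_rectangle:
  assumes A: "finite A" and qr: "prime q" "prime r" "q \<noteq> r" and v: "vanishes (q * r) A"
    and y: "y < q" "y' < q" and z: "z < r" "z' < r"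
  shows "(\<Sum>a\<in>A. (of_bool (a mod q = y) - of_bool (a mod q = y')) *
                  (of_bool (a mod r = z) - of_bool (a mod r = z'))) = (0::int)"
proof -
  have pos: "q > 0" "r > 0" using qr prime_gt_0_nat by auto
  have "char_span (primitive_roots_unity (q * r))
      (\<lambda>a. (of_bool (a mod q = y) - of_bool (a mod q = y')) *
           (of_bool (a mod r = z) - of_bool (a mod r = z')))"
    by (rule char_span_mult[OF _ _ _ _ char_span_residue_diff[OF y] char_span_residue_diff[OF z]])
      (use pos primitive_roots_unity_prime qr primes_coprime finite_primitive_roots_unity
        in \<open>auto intro!: primitive_roots_unity_mult finite_roots_unity\<close>)
  hence "(\<Sum>a\<in>A. (of_bool (a mod q = y) - of_bool (a mod q = y')) *
                  (of_bool (a mod r = z) - of_bool (a mod r = z'))) = (0::complex)"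
    by (rule sum_char_span_eq_0[rotated]) (use v in \<open>simp add: vanishes_def\<close>)
  hence "complex_of_int (\<Sum>a\<in>A. (of_bool (a mod q = y) - of_bool (a mod q = y')) *
                  (of_bool (a mod r = z) - of_bool (a mod r = z'))) = complex_of_int 0"
    by simp
  thus ?thesis by (simp only: of_int_eq_iff)
qed

text \<open>As for rectangles, with primitive roots of order \<open>p q r\<close>: the summand is the sign of a corner of the box, and 0
elsewhere.\<close>

lemma vanishes_box:
  assumes A: "finite A" and pqr: "prime p" "prime q" "prime r" "p \<noteq> q" "p \<noteq> r" "q \<noteq> r"
    and v: "vanishes (p * q * r) A"
    and x: "x < p" "x' < p" and y: "y < q" "y' < q" and z: "z < r" "z' < r"
  shows "(\<Sum>a\<in>A. (of_bool (a mod p = x) - of_bool (a mod p = x')) *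
                  (of_bool (a mod q = y) - of_bool (a mod q = y')) *
                  (of_bool (a mod r = z) - of_bool (a mod r = z'))) = (0::int)"
proof -
  have pos: "p > 0" "q > 0" "r > 0" using pqr prime_gt_0_nat by auto
  have cop: "coprime p q" "coprime (p * q) r" using pqr primes_coprime by auto
  have "char_span (primitive_roots_unity (p * q))
      (\<lambda>a. (of_bool (a mod p = x) - of_bool (a mod p = x')) *
           (of_bool (a mod q = y) - of_bool (a mod q = y')))"
    by (rule char_span_mult[OF _ _ _ _ char_span_residue_diff[OF x] char_span_residue_diff[OF y]])
      (use pos primitive_roots_unity_prime pqr cop finite_primitive_roots_unity
        in \<open>auto intro!: primitive_roots_unity_mult finite_roots_unity\<close>)
  hence "char_span (primitive_roots_unity (p * q * r))
      (\<lambda>a. (of_bool (a mod p = x) - of_bool (a mod p = x')) *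
           (of_bool (a mod q = y) - of_bool (a mod q = y')) *
           (of_bool (a mod r = z) - of_bool (a mod r = z')))"
    by (rule char_span_mult[OF _ _ _ _ _ char_span_residue_diff[OF z], rotated 4])
      (use pos primitive_roots_unity_prime pqr cop finite_primitive_roots_unity
        in \<open>auto intro!: primitive_roots_unity_mult finite_roots_unity\<close>)
  hence "(\<Sum>a\<in>A. (of_bool (a mod p = x) - of_bool (a mod p = x')) *
                  (of_bool (a mod q = y) - of_bool (a mod q = y')) *
                  (of_bool (a mod r = z) - of_bool (a mod r = z'))) = (0::complex)"
    by (rule sum_char_span_eq_0[rotated]) (use v in \<open>simp add: vanishes_def\<close>)
  hence "complex_of_int (\<Sum>a\<in>A. (of_bool (a mod p = x) - of_bool (a mod p = x')) *
                  (of_bool (a mod q = y) - of_bool (a mod q = y')) *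
                  (of_bool (a mod r = z) - of_bool (a mod r = z'))) = complex_of_int 0"
    by simp
  thus ?thesis by (simp only: of_int_eq_iff)
qed

lemma sum_eq_0_imp_neg:
  fixes f :: "'a \<Rightarrow> int"
  assumes "finite A" "(\<Sum>a\<in>A. f a) = 0" "a \<in> A" "f a > 0"
  obtains b where "b \<in> A" "f b < 0"
proof -
  have "\<not> (\<forall>b\<in>A. f b \<ge> 0)"
    using assms sum_nonneg_eq_0_iff[OF assms(1), of f] by force
  thus ?thesis using that by force
qed

text \<open>The corner \<open>a\<close> counts positively in the alternating sum, so some point of \<open>A\<close> lies on a corner that counts
negatively.\<close>

lemma vanishes_rectangle_corner:
  assumes A: "finite A" and qr: "prime q" "prime r" "q \<noteq> r" and v: "vanishes (q * r) A"
    and a: "a \<in> A" and y: "y < q" "y \<noteq> a mod q" and z: "z < r" "z \<noteq> a mod r"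
  obtains b where "b \<in> A" "b mod q = a mod q \<and> b mod r = z \<or> b mod q = y \<and> b mod r = a mod r"
proof -
  have "a mod q < q" "a mod r < r" using y z by auto
  note sum0 = vanishes_rectangle[OF A qr v this(1) y(1) this(2) z(1)]
  obtain b where b: "b \<in> A" "(of_bool (b mod q = a mod q) - of_bool (b mod q = y)) *
                  (of_bool (b mod r = a mod r) - of_bool (b mod r = z)) < (0::int)"
    using sum_eq_0_imp_neg[OF A sum0 a] y z by auto
  hence "b mod q = a mod q \<and> b mod r = z \<or> b mod q = y \<and> b mod r = a mod r"
    by (auto simp: of_bool_def split: if_splits)
  thus ?thesis using that b by blast
qed

text \<open>As for rectangles; the negative corners are those at which one or all three coordinates are changed.\<close>

lemma vanishes_box_corner:
  assumes A: "finite A" and pqr: "prime p" "prime q" "prime r" "p \<noteq> q" "p \<noteq> r" "q \<noteq> r"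
    and v: "vanishes (p * q * r) A" and a: "a \<in> A"
    and x: "x < p" "x \<noteq> a mod p" and y: "y < q" "y \<noteq> a mod q" and z: "z < r" "z \<noteq> a mod r"
  obtains b where "b \<in> A"
    "b mod p = x \<and> b mod q = a mod q \<and> b mod r = a mod r \<or>
     b mod p = a mod p \<and> b mod q = y \<and> b mod r = a mod r \<or>
     b mod p = a mod p \<and> b mod q = a mod q \<and> b mod r = z \<or>
     b mod p = x \<and> b mod q = y \<and> b mod r = z"
proof -
  have "a mod p < p" "a mod q < q" "a mod r < r" using x y z by auto
  note sum0 = vanishes_box[OF A pqr v this(1) x(1) this(2) y(1) this(3) z(1)]
  obtain b where b: "b \<in> A" "(of_bool (b mod p = a mod p) - of_bool (b mod p = x)) *
                  (of_bool (b mod q = a mod q) - of_bool (b mod q = y)) *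
                  (of_bool (b mod r = a mod r) - of_bool (b mod r = z)) < (0::int)"
    using sum_eq_0_imp_neg[OF A sum0 a] x y z by auto
  show ?thesis
    by (rule that[OF b(1)]) (use b(2) in \<open>auto simp: of_bool_def split: if_splits\<close>)
qed

text \<open>By the rectangle identity, the number of elements over a cell \<open>(y, z)\<close> has the form \<open>f y + g z\<close>. As \<open>A\<close> is not
equidistributed modulo \<open>q\<close>, some row exceeds another, and by the same amount in every cell; likewise some column.
Every cell of this row and of this column is therefore nonempty, and their common cell has at least two
elements.\<close>

lemma vanishes_two_primes_card_ge:
  assumes A: "finite A" and qr: "prime q" "prime r" "q \<noteq> r" and v: "vanishes (q * r) A"
    and nv: "\<not> vanishes q A" "\<not> vanishes r A"
  shows "q + r \<le> card A"
proof -
  define c where "c y z = card {a \<in> A. a mod q = y \<and> a mod r = z}" for y z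
  have pos: "q > 0" "r > 0" using qr prime_gt_0_nat by auto
  have rect: "int (c y z) - int (c y z') - int (c y' z) + int (c y' z') = 0"
    if "y < q" "y' < q" "z < r" "z' < r" for y y' z z'
  proof -
    have *: "int (c u w) = (\<Sum>a\<in>A. of_bool (a mod q = u) * of_bool (a mod r = w))" for u w
      unfolding c_def using sum_of_bool_eq_card[OF A, of "\<lambda>a. a mod q = u \<and> a mod r = w", where 'a = int]
      by (simp only: of_bool_conj)
    show ?thesis using vanishes_rectangle[OF A qr v that]
      unfolding * by (simp add: algebra_simps sum.distrib sum_subtractf)
  qed
  have rowq: "residue_count q A y = (\<Sum>z<r. c y z)" for y
  proof -
    have "card {a \<in> A. a mod q = y} = (\<Sum>a | a \<in> A \<and> a mod q = y. 1)" by simp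
    also have "\<dots> = (\<Sum>z<r. \<Sum>a | a \<in> {a \<in> A. a mod q = y} \<and> a mod r = z. 1)"
      by (rule sum.group[symmetric]) (use A pos in auto)
    finally show ?thesis by (simp add: residue_count_def c_def conj_assoc)
  qed
  have rowr: "residue_count r A z = (\<Sum>y<q. c y z)" for z
  proof -
    have "card {a \<in> A. a mod r = z} = (\<Sum>a | a \<in> A \<and> a mod r = z. 1)" by simp
    also have "\<dots> = (\<Sum>y<q. \<Sum>a | a \<in> {a \<in> A. a mod r = z} \<and> a mod q = y. 1)"
      by (rule sum.group[symmetric]) (use A pos in auto)
    finally show ?thesis by (simp add: residue_count_def c_def conj_ac)
  qed
  obtain y1 y0 where y: "y1 < q" "y0 < q" "residue_count q A y0 < residue_count q A y1"
    using nv(1) unfolding vanishes_prime_iff[OF A qr(1)] by (metis linorder_neqE_nat)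
  obtain z1 z0 where z: "z1 < r" "z0 < r" "residue_count r A z0 < residue_count r A z1"
    using nv(2) unfolding vanishes_prime_iff[OF A qr(2)] by (metis linorder_neqE_nat)
  have cy: "c y0 w < c y1 w" if w: "w < r" for w
  proof (rule ccontr)
    assume "\<not> ?thesis"
    hence "c y1 u \<le> c y0 u" if "u < r" for u using rect[OF y(1,2) that w] by linarith
    hence "(\<Sum>u<r. c y1 u) \<le> (\<Sum>u<r. c y0 u)" by (intro sum_mono) simp
    thus False using y(3) by (simp add: rowq)
  qed
  have cz: "c w z0 < c w z1" if w: "w < q" for w
  proof (rule ccontr)
    assume "\<not> ?thesis"
    hence "c u z1 \<le> c u z0" if "u < q" for u using rect[OF that w z(1,2)] by linarith
    hence "(\<Sum>u<q. c u z1) \<le> (\<Sum>u<q. c u z0)" by (intro sum_mono) simp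
    thus False using z(3) by (simp add: rowr)
  qed
  have "q + r = (\<Sum>u<q. 1) + r * (\<Sum>u<q. if u = y1 then 1 else 0)" using y(1) by simp
  also have "\<dots> = (\<Sum>u<q. \<Sum>w<r. of_bool (u = y1) + of_bool (w = z1))"
    unfolding sum_distrib_left sum.distrib[symmetric]
    by (rule sum.cong[OF refl]) (use z(1) in \<open>simp add: sum.distrib of_bool_def\<close>)
  also have "\<dots> \<le> (\<Sum>u<q. \<Sum>w<r. c u w)"
  proof (intro sum_mono)
    fix u w assume "u \<in> {..<q}" "w \<in> {..<r}"
    thus "of_bool (u = y1) + of_bool (w = z1) \<le> c u w"
      using cy[of w] cz[of u] cz[OF y(2)] by (auto simp: of_bool_def)
  qed
  also have "\<dots> = card A" unfolding rowq[symmetric] by (rule sum_residue_count[OF A pos(1)])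
  finally show ?thesis .
qed

section \<open>Spectral sets for a product of three primes\<close>

lemma exists_other_residue:
  assumes "prime s"
  obtains z where "z < s" "z \<noteq> (a::nat) mod s"
proof (cases "a mod s = 0")
  case True
  thus ?thesis using that[of 1] assms prime_gt_1_nat by simp
next
  case False
  thus ?thesis using that[of 0] assms prime_gt_0_nat by simp
qed

text \<open>Residues modulo \<open>p\<close>, \<open>q\<close>, \<open>r\<close> serve as coordinates. The situation is symmetric in the three primes and in the two
sets, and the interpretations obtained from \<open>flip\<close>, \<open>swap_qr\<close> and \<open>swap_pq\<close> transfer each result along these
symmetries.\<close>

locale spectral_pqr =
  fixes p q r :: nat and A B :: "nat set"
  assumes primes: "prime p" "prime q" "prime r" "p \<noteq> q" "p \<noteq> r" "q \<noteq> r"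
    and pair: "spectral_pair (p * q * r) A B"
begin

lemma pos: "p > 0" "q > 0" "r > 0" "p * q * r > 0"
  using primes prime_gt_0_nat by auto

lemma sub: "A \<subseteq> {..<p * q * r}" "B \<subseteq> {..<p * q * r}"
  and ne: "A \<noteq> {}" and card_eq: "card B = card A"
  using pair by (auto simp: spectral_pair_def)

lemma fin: "finite A" "finite B"
  using sub finite_subset by blast+

lemma card_pos: "card A > 0"
  using fin ne by (simp add: card_gt_0_iff)

lemma flip: "spectral_pqr p q r B A"
  by unfold_locales (use primes spectral_pair_sym[OF pair] in auto)

lemma swap_qr: "spectral_pqr p r q A B"
  by unfold_locales (use primes pair in \<open>auto simp: ac_simps\<close>)

lemma swap_pq: "spectral_pqr q p r A B"
  by unfold_locales (use primes pair in \<open>auto simp: ac_simps\<close>)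

lemma eqI:
  assumes "a \<in> A" "a' \<in> A" "a mod p = a' mod p" "a mod q = a' mod q" "a mod r = a' mod r"
  shows "a = a'"
proof -
  have "[a = a'] (mod p * q)"
    using mod_prime_mult_eqI[of p q a a'] primes assms by (simp add: cong_def)
  moreover have "coprime (p * q) r" using primes primes_coprime by auto
  ultimately have "[a = a'] (mod p * q * r)"
    using coprime_cong_mult_nat assms(5) unfolding cong_def by blast
  moreover have "a < p * q * r" "a' < p * q * r" using assms sub by auto
  ultimately show ?thesis by (simp add: cong_def)
qed

lemma differ_p:
  assumes "a \<in> A" "a' \<in> A" "a \<noteq> a'" "a mod q = a' mod q" "a mod r = a' mod r"
  shows "vanishes p B"
proof (rule spectral_pair_vanishes[OF pair _ pos(4) assms(1,2)])
  show "p * q * r = (q * r) * p" by simp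
  show "a mod (q * r) = a' mod (q * r)" by (rule mod_prime_mult_eqI) (use primes assms in auto)
  show "p > 1" using primes prime_gt_1_nat by blast
  fix s :: nat assume "prime s" "s dvd p"
  hence "s = p" using primes primes_dvd_imp_eq by blast
  thus "a mod s \<noteq> a' mod s" using eqI assms by blast
qed

lemma differ_pq:
  assumes "a \<in> A" "a' \<in> A" "a mod p \<noteq> a' mod p" "a mod q \<noteq> a' mod q" "a mod r = a' mod r"
  shows "vanishes (p * q) B"
proof (rule spectral_pair_vanishes[OF pair _ pos(4) assms(1,2,5)])
  show "p * q * r = r * (p * q)" by simp
  show "p * q > 1" using primes prime_gt_1_nat by (metis less_1_mult)
  fix s :: nat assume "prime s" "s dvd p * q"
  hence "s = p \<or> s = q" using primes primes_dvd_imp_eq prime_dvd_mult_iff by blast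
  thus "a mod s \<noteq> a' mod s" using assms by auto
qed

lemma differ_pqr:
  assumes "a \<in> A" "a' \<in> A" "a mod p \<noteq> a' mod p" "a mod q \<noteq> a' mod q" "a mod r \<noteq> a' mod r"
  shows "vanishes (p * q * r) B"
proof (rule spectral_pair_vanishes[OF pair _ pos(4) assms(1,2)])
  show "p * q * r = 1 * (p * q * r)" by simp
  show "p * q * r > 1" using primes prime_gt_1_nat by (metis less_1_mult)
  fix s :: nat assume s: "prime s" "s dvd p * q * r"
  hence "s dvd p \<or> s dvd q \<or> s dvd r" by (simp add: prime_dvd_mult_iff)
  hence "s = p \<or> s = q \<or> s = r" using s primes primes_dvd_imp_eq by blast
  thus "a mod s \<noteq> a' mod s" using assms by auto
qed simp

text \<open>If \<open>r\<close> divides the size as well, \<open>A\<close> is everything. If not, \<open>vanishes r B\<close> fails, so elements of \<open>A\<close> never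
differ in the coordinate \<open>r\<close> alone; then \<open>A\<close> injects into the residues modulo \<open>p q\<close>, and its size is a multiple
of \<open>p q\<close>.\<close>

lemma two_primes_dvd_card:
  assumes "p dvd card A" "q dvd card A"
  shows "\<exists>M. M dvd p * q * r \<and> transversal M A"
proof (cases "r dvd card A")
  case True
  have "coprime p q" "coprime (p * q) r" using primes primes_coprime by auto
  hence "p * q * r dvd card A" using assms True divides_mult by blast
  moreover have "card A \<le> p * q * r" using card_mono[OF _ sub(1)] by simp
  ultimately have "card A = p * q * r" using card_pos dvd_imp_le by (simp add: le_antisym)
  moreover from this have "A = {..<p * q * r}" using sub(1) by (intro card_subset_eq) auto
  hence "inj_on (\<lambda>a. a mod (p * q * r)) A" by (auto simp: inj_on_def)
  ultimately have "transversal (p * q * r) A" by (intro transversalI_inj pos)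
  thus ?thesis by (intro exI[of _ "p * q * r"]) simp
next
  case False
  have "coprime p q" using primes primes_coprime by auto
  hence dvd: "p * q dvd card A" using assms divides_mult by blast
  have inj: "inj_on (\<lambda>a. a mod (p * q)) A"
  proof (rule inj_onI, rule ccontr)
    fix a a' assume a: "a \<in> A" "a' \<in> A" "a mod (p * q) = a' mod (p * q)" "a \<noteq> a'"
    interpret rqp: spectral_pqr r p q A B
      using swap_qr spectral_pqr.swap_pq by blast
    have "a mod p = a' mod p" "a mod q = a' mod q"
      using arg_cong[OF a(3), of "\<lambda>x. x mod p"] arg_cong[OF a(3), of "\<lambda>x. x mod q"]
      by (simp_all add: mod_mod_cancel)
    hence "vanishes r B" using rqp.differ_p a by blast
    hence "r dvd card B" using vanishes_prime_imp_dvd_card fin primes by blast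
    thus False using False card_eq by simp
  qed
  have "card A \<le> card {..<p * q}"
    by (rule card_inj_on_le[OF inj]) (use pos in auto)
  hence "card A = p * q" using dvd card_pos dvd_imp_le by (simp add: le_antisym)
  hence "transversal (p * q) A" using inj pos by (intro transversalI_inj) auto
  thus ?thesis by (meson dvd_triv_left)
qed

end

text \<open>At most the prime \<open>p\<close> divides the common size. Equidistribution modulo \<open>q\<close> or \<open>r\<close> is then impossible for both sets,
so two elements of the same set never differ in the coordinate \<open>q\<close> alone or in the coordinate \<open>r\<close> alone
(\<open>eq_if_pr\<close>, \<open>eq_if_pq\<close>).\<close>

locale spectral_pqr_one_prime = spectral_pqr +
  assumes not_dvd: "\<not> q dvd card A" "\<not> r dvd card A"
begin

lemma flip_one_prime: "spectral_pqr_one_prime p q r B A"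
proof -
  interpret f: spectral_pqr p q r B A by (rule flip)
  show ?thesis by unfold_locales (use not_dvd card_eq in auto)
qed

lemma swap_one_prime: "spectral_pqr_one_prime p r q A B"
proof -
  interpret s: spectral_pqr p r q A B by (rule swap_qr)
  show ?thesis by unfold_locales (use not_dvd in auto)
qed

lemma not_vanishes: "\<not> vanishes q A" "\<not> vanishes r A" "\<not> vanishes q B" "\<not> vanishes r B"
  using not_dvd vanishes_prime_imp_dvd_card fin primes card_eq by metis+

lemma eq_if_pr:
  assumes "a \<in> A" "a' \<in> A" "a mod p = a' mod p" "a mod r = a' mod r"
  shows "a = a'"
proof -
  interpret qpr: spectral_pqr q p r A B by (rule swap_pq)
  show ?thesis using qpr.differ_p not_vanishes assms by blast
qed

lemma eq_if_pq:
  assumes "a \<in> A" "a' \<in> A" "a mod p = a' mod p" "a mod q = a' mod q"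
  shows "a = a'"
  using spectral_pqr_one_prime.eq_if_pr[OF swap_one_prime] assms by blast

text \<open>Suppose that the point over \<open>x\<close> on the line through \<open>a\<close> is missing. In a box at \<open>a\<close> with this point as
a corner, the negative corners that differ from \<open>a\<close> in the coordinate \<open>q\<close> alone or \<open>r\<close> alone are not in \<open>A\<close>
either, so the opposite corner is. As \<open>q \<ge> 3\<close>, there are two choices for its coordinate \<open>q\<close>, which gives two elements of
\<open>A\<close> that differ in this coordinate alone.\<close>

lemma line_full_aux:
  assumes v: "vanishes (p * q * r) A" and a: "a \<in> A" and x: "x < p" and q3: "q \<ge> 3"
  obtains b where "b \<in> A" "b mod p = x" "b mod q = a mod q" "b mod r = a mod r"
proof (cases "\<exists>b\<in>A. b mod p = x \<and> b mod q = a mod q \<and> b mod r = a mod r")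
  case True
  thus ?thesis using that by blast
next
  case no: False
  have x_ne: "x \<noteq> a mod p" using no a by blast
  obtain y y' where y: "y < q" "y' < q" "y \<noteq> y'" "y \<noteq> a mod q" "y' \<noteq> a mod q"
  proof -
    consider "a mod q = 0" | "a mod q = 1" | "a mod q \<noteq> 0" "a mod q \<noteq> 1" by blast
    thus ?thesis
    proof cases
      case 1
      thus ?thesis using that[of 1 2] q3 by simp
    next
      case 2
      thus ?thesis using that[of 0 2] q3 by simp
    next
      case 3
      thus ?thesis using that[of 0 1] q3 by simp
    qed
  qed
  obtain z where z: "z < r" "z \<noteq> a mod r" using exists_other_residue primes by metis
  have cell: "\<exists>b\<in>A. b mod p = x \<and> b mod q = u \<and> b mod r = z" if u: "u < q" "u \<noteq> a mod q" for u
  proof -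
    obtain b where b: "b \<in> A"
      "b mod p = x \<and> b mod q = a mod q \<and> b mod r = a mod r \<or>
       b mod p = a mod p \<and> b mod q = u \<and> b mod r = a mod r \<or>
       b mod p = a mod p \<and> b mod q = a mod q \<and> b mod r = z \<or>
       b mod p = x \<and> b mod q = u \<and> b mod r = z"
      using vanishes_box_corner[OF fin(1) primes v a x x_ne u z] by blast
    moreover have "\<not> (b mod p = a mod p \<and> b mod q = u \<and> b mod r = a mod r)"
      using eq_if_pr[OF b(1) a] u(2) by blast
    moreover have "\<not> (b mod p = a mod p \<and> b mod q = a mod q \<and> b mod r = z)"
      using eq_if_pq[OF b(1) a] z(2) by blast
    ultimately show ?thesis using no by blast
  qed
  obtain b b' where "b \<in> A" "b mod p = x \<and> b mod q = y \<and> b mod r = z"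
    "b' \<in> A" "b' mod p = x \<and> b' mod q = y' \<and> b' mod r = z"
    using cell y by metis
  hence "y = y'" using eq_if_pr by metis
  thus ?thesis using y by blast
qed

text \<open>One of the distinct primes \<open>q\<close> and \<open>r\<close> is at least 3, and the two play symmetric roles.\<close>

lemma line_full:
  assumes v: "vanishes (p * q * r) A" and a: "a \<in> A" and x: "x < p"
  obtains b where "b \<in> A" "b mod p = x" "b mod q = a mod q" "b mod r = a mod r"
proof (cases "q \<ge> 3")
  case True
  show ?thesis by (rule line_full_aux[OF v a x True]) (rule that)
next
  case False
  have "q \<ge> 2" "r \<ge> 2" using primes prime_ge_2_nat by auto
  hence r3: "r \<ge> 3" using False primes by simp
  interpret s: spectral_pqr_one_prime p r q A B by (rule swap_one_prime)
  have "vanishes (p * r * q) A" using v by (simp add: ac_simps)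
  then obtain b where "b \<in> A" "b mod p = x" "b mod r = a mod r" "b mod q = a mod q"
    using s.line_full_aux[OF _ a x r3] by blast
  thus ?thesis using that by blast
qed

text \<open>Both sets are unions of full lines in direction \<open>p\<close>. If \<open>A\<close> had two of them, points with equal coordinate \<open>p\<close>
on these lines would give \<open>vanishes (q r) B\<close>. The rectangle identity and the full lines of \<open>B\<close> then produce two elements
of \<open>B\<close> that differ in the coordinate \<open>q\<close> alone or \<open>r\<close> alone.\<close>

lemma transversal_if_both_vanish:
  assumes vA: "vanishes (p * q * r) A" and vB: "vanishes (p * q * r) B"
  shows "transversal p A"
proof -
  interpret f: spectral_pqr_one_prime p q r B A by (rule flip_one_prime)
  interpret qrp: spectral_pqr q r p A B
    using swap_pq spectral_pqr.swap_qr by blast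
  have same: "a mod q = a' mod q \<and> a mod r = a' mod r" if a: "a \<in> A" "a' \<in> A" for a a'
  proof (rule ccontr)
    assume ne: "\<not> ?thesis"
    obtain c where c: "c \<in> A" "c mod p = a mod p" "c mod q = a' mod q" "c mod r = a' mod r"
      using line_full[OF vA a(2), of "a mod p"] pos by auto
    have "c mod q \<noteq> a mod q" "c mod r \<noteq> a mod r"
      using eq_if_pq[OF c(1) a(1)] eq_if_pr[OF c(1) a(1)] c ne by metis+
    hence v: "vanishes (q * r) B" using qrp.differ_pq[OF c(1) a(1)] c by blast
    obtain b where b: "b \<in> B" using f.ne by blast
    obtain y where y: "y < q" "y \<noteq> b mod q" using exists_other_residue primes by metis
    obtain z where z: "z < r" "z \<noteq> b mod r" using exists_other_residue primes by metis
    obtain d where d: "d \<in> B"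
      "d mod q = b mod q \<and> d mod r = z \<or> d mod q = y \<and> d mod r = b mod r"
      using vanishes_rectangle_corner[OF fin(2) primes(2,3,6) v b y z] by blast
    obtain e where e: "e \<in> B" "e mod p = b mod p" "e mod q = d mod q" "e mod r = d mod r"
      using f.line_full[OF vB d(1), of "b mod p"] pos by auto
    have "e = b" using f.eq_if_pq[OF e(1) b] f.eq_if_pr[OF e(1) b] e d(2) by metis
    thus False using d(2) e y z by metis
  qed
  obtain a where a: "a \<in> A" using ne by blast
  have "inj_on (\<lambda>a. a mod p) A" by (rule inj_onI) (use same eqI in metis)
  moreover have "(\<lambda>a. a mod p) ` A = {..<p}"
  proof (intro equalityI subsetI)
    fix x assume "x \<in> {..<p}"
    then obtain b where "b \<in> A" "b mod p = x" using line_full[OF vA a] by auto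
    thus "x \<in> (\<lambda>a. a mod p) ` A" by blast
  qed (use pos in auto)
  ultimately show ?thesis by (simp add: transversal_def bij_betw_def)
qed

text \<open>If two elements had different coordinates \<open>q\<close>, the rectangle that they span would have a further corner occupied,
and its element would share the coordinate \<open>p\<close> with one of the two, although it is different from both.\<close>

lemma same_residue_q_if_transversal:
  assumes t: "transversal p A" and v: "vanishes (p * q) A" and a: "a \<in> A" "a' \<in> A"
  shows "a mod q = a' mod q"
proof (rule ccontr)
  assume ne: "a mod q \<noteq> a' mod q"
  have inj: "b = c" if "b \<in> A" "c \<in> A" "b mod p = c mod p" for b c
    using t that unfolding transversal_def bij_betw_def inj_on_def by blast
  have "a' mod p \<noteq> a mod p" using inj[OF a] ne by metis
  then obtain b where b: "b \<in> A"
    "b mod p = a mod p \<and> b mod q = a' mod q \<or> b mod p = a' mod p \<and> b mod q = a mod q"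
    using vanishes_rectangle_corner[OF fin(1) primes(1,2,4) v a(1), of "a' mod p" "a' mod q"] ne pos
    by (metis mod_less_divisor)
  thus False using inj[OF b(1) a(1)] inj[OF b(1) a(2)] ne by metis
qed

lemma not_line_if_vanishes_qr:
  assumes v: "vanishes (q * r) A"
    and same: "\<And>a a'. a \<in> A \<Longrightarrow> a' \<in> A \<Longrightarrow> a mod q = a' mod q \<and> a mod r = a' mod r"
  shows False
proof -
  obtain a where a: "a \<in> A" using ne by blast
  obtain y where y: "y < q" "y \<noteq> a mod q" using exists_other_residue primes by metis
  obtain z where z: "z < r" "z \<noteq> a mod r" using exists_other_residue primes by metis
  obtain b where "b \<in> A"
    "b mod q = a mod q \<and> b mod r = z \<or> b mod q = y \<and> b mod r = a mod r"
    using vanishes_rectangle_corner[OF fin(1) primes(2,3,6) v a y z] by blast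
  thus False using same[OF a] y z by metis
qed

text \<open>Injectivity gives \<open>card A \<le> p\<close>. Two elements of \<open>B\<close> differ in the coordinate \<open>p\<close> and in at most one of the others,
since \<open>vanishes (p q r) A\<close> fails. Hence \<open>A\<close> vanishes at \<open>p\<close>, at \<open>p q\<close> or at \<open>p r\<close>; without the first, the
other two would force \<open>card A \<ge> p + q\<close> or \<open>card A \<ge> p + r\<close>. So \<open>p\<close> divides the size, which is therefore
\<open>p\<close>.\<close>

lemma transversal_if_injective_mod_p:
  assumes nv: "\<not> vanishes (p * q * r) A" and inj: "inj_on (\<lambda>b. b mod p) B"
    and card: "card A \<noteq> 1"
  shows "transversal p A \<and> transversal p B"
proof -
  interpret f: spectral_pqr_one_prime p q r B A by (rule flip_one_prime)
  interpret fs: spectral_pqr_one_prime p r q B A by (rule f.swap_one_prime)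
  have "card B \<le> card {..<p}" by (rule card_inj_on_le[OF inj]) (use pos in auto)
  hence le: "card A \<le> p" using card_eq by simp
  obtain b b' where b: "b \<in> B" "b' \<in> B" "b \<noteq> b'"
  proof -
    have "card B \<noteq> 1" using card card_eq by simp
    obtain b where "b \<in> B" using f.ne by blast
    moreover have "B \<noteq> {b}" using \<open>card B \<noteq> 1\<close> by auto
    ultimately show ?thesis using that by blast
  qed
  have bp: "b mod p \<noteq> b' mod p" using inj b by (auto dest: inj_onD)
  have "vanishes p A"
  proof (rule ccontr)
    assume np: "\<not> vanishes p A"
    have "b mod q \<noteq> b' mod q \<or> b mod r \<noteq> b' mod r" using f.differ_p b np by blast
    moreover have "b mod q = b' mod q \<or> b mod r = b' mod r"
      using f.differ_pqr b(1,2) bp nv by blast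
    ultimately consider "b mod q \<noteq> b' mod q" "b mod r = b' mod r"
      | "b mod r \<noteq> b' mod r" "b mod q = b' mod q" by blast
    hence "p < card A"
    proof cases
      case 1
      hence "vanishes (p * q) A" using f.differ_pq b bp by blast
      hence "p + q \<le> card A"
        by (rule vanishes_two_primes_card_ge[OF fin(1) primes(1,2,4) _ np not_vanishes(1)])
      thus ?thesis using pos by simp
    next
      case 2
      hence "vanishes (p * r) A" using fs.differ_pq b bp by blast
      hence "p + r \<le> card A"
        by (rule vanishes_two_primes_card_ge[OF fin(1) primes(1,3,5) _ np not_vanishes(2)])
      thus ?thesis using pos by simp
    qed
    thus False using le by simp
  qed
  hence "p dvd card A" using vanishes_prime_imp_dvd_card fin primes by blast
  hence "card A = p" using le card_pos dvd_imp_le by (simp add: le_antisym)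
  thus ?thesis using \<open>vanishes p A\<close> vanishes_prime_imp_transversal[OF fin(1)] primes(1)
      transversalI_inj[OF pos(1) inj] card_eq by simp
qed

text \<open>Any two elements of \<open>B\<close> share a coordinate. Let \<open>b1\<close> and \<open>b2\<close> share the coordinate \<open>p\<close>; they differ in the other two, so
the size is at least \<open>q + r\<close>. Elements off their plane must share the coordinate \<open>q\<close> with one of \<open>b1\<close>, \<open>b2\<close>
and \<open>r\<close> with the other. This leaves no further elements in the plane, and forces all elements off it onto one line in direction \<open>p\<close>. Hence \<open>card A \<le> p + 1\<close> and \<open>vanishes p A\<close>, so the size is
\<open>p\<close> and \<open>A\<close> is a complete system of residues modulo \<open>p\<close>. Comparing the line with \<open>b1\<close> and \<open>b2\<close> yields vanishing at \<open>p q\<close> and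
\<open>p r\<close>, which confines \<open>A\<close> to a single line in direction \<open>p\<close>, against \<open>vanishes (q r) A\<close>.\<close>

lemma injective_mod_p:
  assumes nv: "\<not> vanishes (p * q * r) A"
  shows "inj_on (\<lambda>b. b mod p) B"
proof (rule inj_onI, rule ccontr)
  fix b1 b2 assume b: "b1 \<in> B" "b2 \<in> B" "b1 mod p = b2 mod p" "b1 \<noteq> b2"
  interpret f: spectral_pqr_one_prime p q r B A by (rule flip_one_prime)
  interpret fs: spectral_pqr_one_prime p r q B A by (rule f.swap_one_prime)
  interpret s: spectral_pqr_one_prime p r q A B by (rule swap_one_prime)
  interpret qrp: spectral_pqr q r p B A
    using f.swap_pq spectral_pqr.swap_qr by blast
  have share: "c mod p = c' mod p \<or> c mod q = c' mod q \<or> c mod r = c' mod r"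
    if "c \<in> B" "c' \<in> B" for c c'
    using f.differ_pqr that nv by blast
  have bq: "b1 mod q \<noteq> b2 mod q" and br: "b1 mod r \<noteq> b2 mod r"
    using f.eq_if_pq f.eq_if_pr b by blast+
  have vqr: "vanishes (q * r) A" using qrp.differ_pq b(1-3) bq br by blast
  hence ge: "q + r \<le> card B"
    using vanishes_two_primes_card_ge[OF fin(1) primes(2,3,6) _ not_vanishes(1,2)] card_eq by simp
  have "q \<ge> 2" "r \<ge> 2" using primes prime_ge_2_nat by auto
  \<comment> \<open>distinct primes have sum at least 5; with only 4 elements, the two off the plane need not
    lie on one line\<close>
  hence ge5: "card B \<ge> 5" using ge primes(6) by linarith
  define x where "x = b1 mod p"
  define C where "C = {c \<in> B. c mod p \<noteq> x}"
  have finC: "finite C" using fin by (simp add: C_def)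
  have cell: "c mod q = b1 mod q \<and> c mod r = b2 mod r \<or> c mod q = b2 mod q \<and> c mod r = b1 mod r"
    if "c \<in> C" for c
    using share[of c b1] share[of c b2] that b bq br unfolding C_def x_def by auto
  obtain c where c: "c \<in> C"
  proof -
    have "C \<noteq> {}"
    proof
      assume "C = {}"
      hence all: "d mod p = x" if "d \<in> B" for d using that unfolding C_def by blast
      have "inj_on (\<lambda>c. c mod q) B"
      proof (rule inj_onI)
        fix d e assume "d \<in> B" "e \<in> B" "d mod q = e mod q"
        thus "d = e" using f.eq_if_pq[of d e] all[of d] all[of e] by simp
      qed
      hence "card B \<le> card {..<q}" by (rule card_inj_on_le) (use pos in auto)
      thus False using ge pos by simp
    qed
    thus ?thesis using that by blast
  qed
  \<comment> \<open>an element of the plane must share a coordinate with the element \<open>c\<close> off it, whose coordinates \<open>q\<close> and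
    \<open>r\<close> are taken from \<open>b1\<close> and \<open>b2\<close>\<close>
  have plane: "d = b1 \<or> d = b2" if d: "d \<in> B" "d mod p = x" for d
  proof -
    have "d mod q = c mod q \<or> d mod r = c mod r" using share[of d c] c d by (auto simp: C_def)
    thus ?thesis
      using cell[OF c] f.eq_if_pq[OF d(1) b(1)] f.eq_if_pq[OF d(1) b(2)]
        f.eq_if_pr[OF d(1) b(1)] f.eq_if_pr[OF d(1) b(2)] d(2) b(3) by (auto simp: x_def)
  qed
  have "B \<subseteq> {b1, b2} \<union> C" using plane by (auto simp: C_def)
  hence "card B \<le> card ({b1, b2} \<union> C)" using finC by (intro card_mono) auto
  also have "\<dots> \<le> card {b1, b2} + card C" by (rule card_Un_le)
  finally have leC: "card B \<le> 2 + card C" using b(4) by simp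
  hence C3: "card C \<ge> 3" using ge5 by simp
  have same_cell: "d mod q = c mod q \<and> d mod r = c mod r" if d: "d \<in> C" for d
  proof (rule ccontr)
    assume ne: "\<not> ?thesis"
    have diff: "d mod q \<noteq> c mod q" "d mod r \<noteq> c mod r" using cell[OF c] cell[OF d] ne bq br by auto
    \<comment> \<open>elements over the two different cells share the coordinate \<open>p\<close>, which leaves one element in each
      cell\<close>
    have "C \<subseteq> {c, d}"
    proof
      fix e assume e: "e \<in> C"
      have "d mod p = c mod p" using share[of d c] diff c d by (auto simp: C_def)
      moreover have "e mod q = c mod q \<and> e mod r = c mod r \<or> e mod q = d mod q \<and> e mod r = d mod r"
        using cell[OF c] cell[OF d] cell[OF e] diff by metis
      moreover from this have "e mod p = d mod p \<or> e mod p = c mod p"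
        using share[of e c] share[of e d] diff c d e by (auto simp: C_def)
      ultimately have "e = c \<or> e = d"
        using f.eqI[of e c] f.eqI[of e d] c d e by (auto simp: C_def)
      thus "e \<in> {c, d}" by blast
    qed
    hence "card C \<le> card {c, d}" by (intro card_mono) auto
    also have "\<dots> \<le> 2" by (simp add: card_insert_if)
    finally show False using C3 by simp
  qed
  have "vanishes p A"
  proof -
    have "C \<noteq> {c}" using C3 by auto
    then obtain d where "d \<in> C" "d \<noteq> c" using c by blast
    thus ?thesis using f.differ_p[of d c] same_cell c by (auto simp: C_def)
  qed
  hence dvd: "p dvd card A" using vanishes_prime_imp_dvd_card fin primes by blast
  have "inj_on (\<lambda>c. c mod p) C"
    by (rule inj_onI) (use same_cell f.eqI in \<open>metis (no_types, lifting) C_def mem_Collect_eq\<close>)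
  hence "card C \<le> card ({..<p} - {x})"
    by (rule card_inj_on_le) (use pos in \<open>auto simp: C_def\<close>)
  also have "\<dots> = p - 1" using pos by (simp add: x_def)
  finally have "card A \<le> p + 1" using leC pos card_eq by simp
  moreover have "p \<ge> 2" using primes prime_ge_2_nat by blast
  ultimately have "card A = p"
  proof -
    obtain k where k: "card A = p * k" using dvd by (rule dvdE)
    have "p * k < p * 2" using k \<open>card A \<le> p + 1\<close> \<open>p \<ge> 2\<close> ge5 card_eq by linarith
    hence "k < 2" by simp
    moreover have "k \<noteq> 0" using k card_pos by auto
    ultimately have "k = 1" by simp
    thus ?thesis using k by simp
  qed
  hence t: "transversal p A"
    using vanishes_prime_imp_transversal[OF fin(1)] \<open>vanishes p A\<close> primes(1) by blast
  have cB: "c \<in> B" "c mod p \<noteq> b1 mod p" "c mod p \<noteq> b2 mod p" using c b by (auto simp: C_def x_def)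
  have "vanishes (p * q) A \<and> vanishes (p * r) A"
    using cell[OF c] f.differ_pq[OF cB(1)] fs.differ_pq[OF cB(1)] cB b bq br by metis
  hence "a mod q = a' mod q \<and> a mod r = a' mod r" if "a \<in> A" "a' \<in> A" for a a'
    using same_residue_q_if_transversal[OF t] s.same_residue_q_if_transversal[OF t] that by blast
  thus False using not_line_if_vanishes_qr[OF vqr] by blast
qed

text \<open>The three cases are that \<open>vanishes (p q r)\<close> holds for both sets, fails for \<open>A\<close>, or fails for \<open>B\<close>; the last two are
symmetric because the conclusion of \<open>transversal_if_injective_mod_p\<close> concerns both sets.\<close>

lemma exists_transversal_one_prime: "\<exists>M. M dvd p * q * r \<and> transversal M A"
proof -
  interpret f: spectral_pqr_one_prime p q r B A by (rule flip_one_prime)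
  have "card A = 1 \<or> transversal p A"
    using transversal_if_both_vanish transversal_if_injective_mod_p[OF _ injective_mod_p]
      f.transversal_if_injective_mod_p[OF _ f.injective_mod_p] card_eq by metis
  moreover have "transversal 1 A" if "card A = 1"
    using that by (intro transversalI_inj) (auto simp: card_1_singleton_iff)
  ultimately show ?thesis by (metis dvd_triv_left mult.assoc one_dvd)
qed

end

lemma (in spectral_pqr) exists_transversal: "\<exists>M. M dvd p * q * r \<and> transversal M A"
proof -
  interpret prq: spectral_pqr p r q A B by (rule swap_qr)
  interpret qpr: spectral_pqr q p r A B by (rule swap_pq)
  interpret qrp: spectral_pqr q r p A B by (rule qpr.swap_qr)
  interpret rpq: spectral_pqr r p q A B by (rule prq.swap_pq)
  have perm: "p * r * q = p * q * r" "q * p * r = p * q * r" "q * r * p = p * q * r"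
    "r * p * q = p * q * r" by simp_all
  consider "p dvd card A" "q dvd card A" | "p dvd card A" "r dvd card A"
    | "q dvd card A" "r dvd card A" | "\<not> q dvd card A" "\<not> r dvd card A"
    | "\<not> p dvd card A" "\<not> r dvd card A" | "\<not> p dvd card A" "\<not> q dvd card A" by blast
  thus ?thesis
  proof cases
    case 1
    thus ?thesis by (rule two_primes_dvd_card)
  next
    case 2
    thus ?thesis using prq.two_primes_dvd_card perm by simp
  next
    case 3
    thus ?thesis using qrp.two_primes_dvd_card perm by simp
  next
    case 4
    interpret spectral_pqr_one_prime p q r A B by unfold_locales (use 4 in auto)
    show ?thesis by (rule exists_transversal_one_prime)
  next
    case 5
    interpret o: spectral_pqr_one_prime q p r A B by unfold_locales (use 5 in auto)
    show ?thesis using o.exists_transversal_one_prime perm by simp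
  next
    case 6
    interpret o: spectral_pqr_one_prime r p q A B by unfold_locales (use 6 in auto)
    show ?thesis using o.exists_transversal_one_prime perm by simp
  qed
qed

theorem theorem1p3:
  fixes p q r N :: nat and A :: "nat set"
  assumes "prime p" "prime q" "prime r"
    and "p \<noteq> q" "p \<noteq> r" "q \<noteq> r"
    and "N = p * q * r"
    and "A \<subseteq> {..<N}" "A \<noteq> {}"
  shows "(T1 N A \<and> T2 N A \<longleftrightarrow> spectral N A) \<and> (spectral N A \<longleftrightarrow> tiles N A)"
proof -
  let ?M = "\<exists>M. M dvd N \<and> transversal M A"
  have "coprime p q" "coprime (p * q) r" using assms primes_coprime by auto
  hence N: "squarefree N"
    using assms by (simp add: squarefree_mult_coprime squarefree_prime)
  hence N0: "N > 0" using not_squarefree_0 by (metis gr0I)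
  have fin: "finite A" using assms(8) finite_subset by blast
  have T: "T1 N A \<and> T2 N A \<longleftrightarrow> ?M" by (rule T1_T2_iff_transversal[OF N fin assms(9)])
  have S: "spectral N A \<longleftrightarrow> ?M"
  proof
    assume "spectral N A"
    then obtain B where "spectral_pair N A B"
      using spectral_imp_spectral_pair assms(8,9) by blast
    then interpret spectral_pqr p q r A B using assms by unfold_locales auto
    show ?M using exists_transversal assms(7) by simp
  qed (use transversal_imp_spectral[OF N0 _ fin assms(9)] in blast)
  have "tiles N A \<longleftrightarrow> ?M"
    using tiles_imp_transversal[OF N assms(8,9)] transversal_imp_tiles[OF N0] by blast
  with T S show ?thesis by blast
qed

end
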